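(* Let $G=H(C)$ be the Polish homeomorphism group of the Cantor set $C$ (with the topology of uniform convergence). Then the universal minimal $G$-flow $M(G)$ is SUC-trivial (hence, $G$ has the SUC-fpp).
   Context: A $G$-space (or $G$-flow) is a Tychonoff space with a continuous left action of the topological group $G$. A compact $G$-space is minimal if every orbit is dense; $M(G)$ is the universal minimal compact $G$-flow (the unique up to isomorphism minimal compact $G$-flow having every minimal compact $G$-flow as a factor). A compact $G$-space $Y$, with its unique compatible uniformity $\mu_Y$, is SUC if for every $y_0\in Y$ and every $\varepsilon\in\mu_Y$ there is a neighborhood $U$ of $e$ such that $(guy_0,gy_0)\in\varepsilon$ for all $g\in G$, $u\in U$. For a $G$-space $X$, $\mathrm{SUC}(X)$ is the set of bounded continuous $f\colon X\to\mathbb{R}$ of the form $f=F\circ\nu$ where $\nu\colon X\to Y$ is a continuous $G$-equivariant map with dense image into a compact SUC $G$-space $Y$ and $F\colon Y\to\mathbb{R}$ is continuous. $X$ is SUC-trivial if $\mathrm{SUC}(X)$ consists only of constants. $G$ has the SUC-fpp if every (nonempty) compact SUC $G$-space has a $G$-fixed point. *)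

theory Defs
  imports "HOL-Analysis.Analysis" "HOL-Algebra.Group_Action"
begin

section \<open>The homeomorphism group of a compact metric space\<close>

definition cantor_topology :: "(nat \<Rightarrow> bool) topology" where
  "cantor_topology = product_topology (\<lambda>_. discrete_topology UNIV) UNIV"

text \<open>Elements of \<^const>\<open>Bij\<close> and of \<^const>\<open>cfunspace\<close> are extensional functions, so that a
  homeomorphism of the space has exactly one representative.\<close>

definition homeo_group :: "'c metric \<Rightarrow> ('c \<Rightarrow> 'c) monoid" where
  "homeo_group C = (BijGroup (mspace C))
     \<lparr>carrier := {f \<in> Bij (mspace C). homeomorphic_map (mtopology_of C) (mtopology_of C) f}\<rparr>"

text \<open>The topology of uniform convergence, i.e. the topology of the supremum metric.\<close>

definition homeo_topology :: "'c metric \<Rightarrow> ('c \<Rightarrow> 'c) topology" where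
  "homeo_topology C =
     subtopology (mtopology_of (cfunspace (mtopology_of C) C)) (carrier (homeo_group C))"


section \<open>Flows\<close>

text \<open>A topological group is given by a group \<open>G\<close> together with a topology \<open>T\<close> on its carrier.\<close>

definition G_space ::
    "('g, 'b) monoid_scheme \<Rightarrow> 'g topology \<Rightarrow> 'x topology \<Rightarrow> ('g \<Rightarrow> 'x \<Rightarrow> 'x) \<Rightarrow> bool" where
  "G_space G T X \<phi> \<longleftrightarrow>
     completely_regular_space X \<and> Hausdorff_space X \<and>
     group_action G (topspace X) \<phi> \<and>
     continuous_map (prod_topology T X) X (\<lambda>(g, x). \<phi> g x)"

definition compact_G_space ::
    "('g, 'b) monoid_scheme \<Rightarrow> 'g topology \<Rightarrow> 'x topology \<Rightarrow> ('g \<Rightarrow> 'x \<Rightarrow> 'x) \<Rightarrow> bool" where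
  "compact_G_space G T X \<phi> \<longleftrightarrow> G_space G T X \<phi> \<and> compact_space X"

definition G_map ::
    "('g, 'b) monoid_scheme \<Rightarrow> 'x topology \<Rightarrow> ('g \<Rightarrow> 'x \<Rightarrow> 'x) \<Rightarrow>
     'y topology \<Rightarrow> ('g \<Rightarrow> 'y \<Rightarrow> 'y) \<Rightarrow> ('x \<Rightarrow> 'y) \<Rightarrow> bool" where
  "G_map G X \<phi> Y \<psi> \<nu> \<longleftrightarrow>
     continuous_map X Y \<nu> \<and> (\<forall>g \<in> carrier G. \<forall>x \<in> topspace X. \<nu> (\<phi> g x) = \<psi> g (\<nu> x))"

text \<open>As usual, the empty flow is not regarded as minimal; otherwise no flow could have all
  minimal flows as factors.\<close>

definition minimal_flow ::
    "('g, 'b) monoid_scheme \<Rightarrow> 'g topology \<Rightarrow> 'x topology \<Rightarrow> ('g \<Rightarrow> 'x \<Rightarrow> 'x) \<Rightarrow> bool" where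
  "minimal_flow G T X \<phi> \<longleftrightarrow>
     compact_G_space G T X \<phi> \<and> topspace X \<noteq> {} \<and>
     (\<forall>x \<in> topspace X. X closure_of (orbit G \<phi> x) = topspace X)"

text \<open>HOL does not allow quantification over the type carrying the minimal flow \<open>N\<close>. In a minimal
  flow any orbit is a dense set indexed by \<open>G\<close>, and a point of a Hausdorff space is determined by
  the traces of its neighbourhoods on a dense set; so every minimal flow has an isomorphic copy on
  the type \<^typ>\<open>'g set set\<close>, and nothing is lost by using this type only
  (see \<open>universal_minimal_flow_factor\<close> below).\<close>

definition universal_minimal_flow ::
    "('g, 'b) monoid_scheme \<Rightarrow> 'g topology \<Rightarrow> 'x topology \<Rightarrow> ('g \<Rightarrow> 'x \<Rightarrow> 'x) \<Rightarrow> bool" where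
  "universal_minimal_flow G T M \<phi> \<longleftrightarrow>
     minimal_flow G T M \<phi> \<and>
     (\<forall>(N :: 'g set set topology) \<psi>. minimal_flow G T N \<psi> \<longrightarrow>
        (\<exists>\<pi>. G_map G M \<phi> N \<psi> \<pi> \<and> \<pi> ` topspace M = topspace N))"


section \<open>The uniformity of a compact Hausdorff space\<close>

text \<open>The axioms are those of the type class \<^class>\<open>uniform_space\<close>, relativised to
  \<open>topspace Y\<close>.\<close>

definition compatible_uniformity :: "'y topology \<Rightarrow> ('y \<times> 'y) filter \<Rightarrow> bool" where
  "compatible_uniformity Y \<U> \<longleftrightarrow>
     eventually (\<lambda>p. p \<in> topspace Y \<times> topspace Y) \<U> \<and>
     (\<forall>E. eventually E \<U> \<longrightarrow> (\<forall>x \<in> topspace Y. E (x, x))) \<and>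
     (\<forall>E. eventually E \<U> \<longrightarrow> eventually (\<lambda>(x, y). E (y, x)) \<U>) \<and>
     (\<forall>E. eventually E \<U> \<longrightarrow>
        (\<exists>D. eventually D \<U> \<and> (\<forall>x y z. D (x, y) \<longrightarrow> D (y, z) \<longrightarrow> E (x, z)))) \<and>
     (\<forall>U. U \<subseteq> topspace Y \<longrightarrow>
        (openin Y U \<longleftrightarrow> (\<forall>x \<in> U. eventually (\<lambda>(x', y). x' = x \<longrightarrow> y \<in> U) \<U>)))"

text \<open>Only meaningful if there is exactly one compatible uniformity; for compact Hausdorff spaces
  see \<open>compatible_uniformity_unique\<close> below.\<close>

definition uniformity_of :: "'y topology \<Rightarrow> ('y \<times> 'y) filter" where
  "uniformity_of Y = (THE \<U>. compatible_uniformity Y \<U>)"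


section \<open>SUC flows and SUC functions\<close>

definition SUC_flow ::
    "('g, 'b) monoid_scheme \<Rightarrow> 'g topology \<Rightarrow> 'y topology \<Rightarrow> ('g \<Rightarrow> 'y \<Rightarrow> 'y) \<Rightarrow> bool" where
  "SUC_flow G T Y \<psi> \<longleftrightarrow>
     compact_G_space G T Y \<psi> \<and>
     (\<forall>y\<^sub>0 \<in> topspace Y. \<forall>E. eventually E (uniformity_of Y) \<longrightarrow>
        (\<exists>U. openin T U \<and> \<one>\<^bsub>G\<^esub> \<in> U \<and>
           (\<forall>g \<in> carrier G. \<forall>u \<in> U. E (\<psi> (g \<otimes>\<^bsub>G\<^esub> u) y\<^sub>0, \<psi> g y\<^sub>0))))"

text \<open>Since \<open>\<nu>\<close> has dense image, \<open>Y\<close> has an isomorphic copy on the type \<^typ>\<open>'x set set\<close>, by the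
  same argument as above; see \<open>SUC_functionsI\<close> below for arbitrary types.\<close>

definition SUC_functions ::
    "('g, 'b) monoid_scheme \<Rightarrow> 'g topology \<Rightarrow> 'x topology \<Rightarrow> ('g \<Rightarrow> 'x \<Rightarrow> 'x) \<Rightarrow> ('x \<Rightarrow> real) set" where
  "SUC_functions G T X \<phi> =
     {f. continuous_map X euclideanreal f \<and> bounded (f ` topspace X) \<and>
         (\<exists>(Y :: 'x set set topology) \<psi> \<nu> F.
            SUC_flow G T Y \<psi> \<and> G_map G X \<phi> Y \<psi> \<nu> \<and>
            Y closure_of (\<nu> ` topspace X) = topspace Y \<and>
            continuous_map Y euclideanreal F \<and>
            (\<forall>x \<in> topspace X. f x = F (\<nu> x)))}"

definition SUC_trivial ::
    "('g, 'b) monoid_scheme \<Rightarrow> 'g topology \<Rightarrow> 'x topology \<Rightarrow> ('g \<Rightarrow> 'x \<Rightarrow> 'x) \<Rightarrow> bool" where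
  "SUC_trivial G T X \<phi> \<longleftrightarrow>
     (\<forall>f \<in> SUC_functions G T X \<phi>. \<exists>c. \<forall>x \<in> topspace X. f x = c)"

text \<open>The fixed point property for flows carried by the type \<open>'y\<close>; the property itself is
  the statement for all types \<open>'y\<close>.\<close>

definition SUC_fpp ::
    "('g, 'b) monoid_scheme \<Rightarrow> 'g topology \<Rightarrow> 'y itself \<Rightarrow> bool" where
  "SUC_fpp G T _ \<longleftrightarrow>
     (\<forall>(Y :: 'y topology) \<psi>. SUC_flow G T Y \<psi> \<and> topspace Y \<noteq> {} \<longrightarrow>
        (\<exists>y \<in> topspace Y. \<forall>g \<in> carrier G. \<psi> g y = y))"


section \<open>Adequacy of the definitions\<close>

subsection \<open>Uniqueness of the compatible uniformity\<close>

lemma compatible_uniformity_nhd: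
  assumes U: "compatible_uniformity Y \<U>" and E: "eventually E \<U>" and x: "x \<in> topspace Y"
  shows "\<exists>V. openin Y V \<and> x \<in> V \<and> (\<forall>y\<in>V. E (x, y))"
proof -
  let ?V = "{y \<in> topspace Y. \<exists>D. eventually D \<U> \<and> (\<forall>z. D (y,z) \<longrightarrow> E (x,z))}"
  have refl: "\<And>D y. eventually D \<U> \<Longrightarrow> y \<in> topspace Y \<Longrightarrow> D (y,y)"
    and tr: "\<And>D. eventually D \<U> \<Longrightarrow>
        \<exists>D'. eventually D' \<U> \<and> (\<forall>x y z. D' (x,y) \<longrightarrow> D' (y,z) \<longrightarrow> D (x,z))"
    and op: "\<And>V. V \<subseteq> topspace Y \<Longrightarrow>
        openin Y V \<longleftrightarrow> (\<forall>x\<in>V. eventually (\<lambda>(x',y). x' = x \<longrightarrow> y \<in> V) \<U>)"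
    and S: "eventually (\<lambda>p. p \<in> topspace Y \<times> topspace Y) \<U>"
    using U unfolding compatible_uniformity_def by blast+
  have "eventually (\<lambda>(x',z). x' = y \<longrightarrow> z \<in> ?V) \<U>" if y: "y \<in> ?V" for y
  proof -
    obtain D where D: "eventually D \<U>" "\<forall>z. D (y,z) \<longrightarrow> E (x,z)" using y by blast
    obtain D' where D': "eventually D' \<U>" "\<forall>x y z. D' (x,y) \<longrightarrow> D' (y,z) \<longrightarrow> D (x,z)"
      using tr[OF D(1)] by blast
    show ?thesis
      by (rule eventually_mono[OF eventually_conj[OF D'(1) S]]) (use D D' in blast)
  qed
  then have "openin Y ?V" using op[of ?V] by blast
  moreover have "x \<in> ?V" using E x by blast
  moreover have "\<forall>y\<in>?V. E (x,y)" using refl by blast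
  ultimately show ?thesis by blast
qed

lemma compatible_uniformity_diagonal:
  assumes "compact_space Y" and U: "compatible_uniformity Y \<U>"
  shows "eventually E \<U> \<longleftrightarrow>
    (\<exists>W. openin (prod_topology Y Y) W \<and> (\<forall>x\<in>topspace Y. (x,x) \<in> W) \<and> (\<forall>p\<in>W. E p))"
proof -
  have refl: "\<And>D y. eventually D \<U> \<Longrightarrow> y \<in> topspace Y \<Longrightarrow> D (y,y)"
    and sym: "\<And>D. eventually D \<U> \<Longrightarrow> eventually (\<lambda>(x,y). D (y,x)) \<U>"
    and tr: "\<And>D. eventually D \<U> \<Longrightarrow>
        \<exists>D'. eventually D' \<U> \<and> (\<forall>x y z. D' (x,y) \<longrightarrow> D' (y,z) \<longrightarrow> D (x,z))"
    and op: "\<And>V. openin Y V \<Longrightarrow> (\<forall>x\<in>V. eventually (\<lambda>(x',y). x' = x \<longrightarrow> y \<in> V) \<U>)"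
    and S: "eventually (\<lambda>p. p \<in> topspace Y \<times> topspace Y) \<U>"
    using U unfolding compatible_uniformity_def by (blast, blast, blast, meson openin_subset, blast)
  note nhd = compatible_uniformity_nhd[OF U]
  show ?thesis
  proof
    assume E: "eventually E \<U>"
    obtain D where D: "eventually D \<U>" "\<forall>x y z. D (x,y) \<longrightarrow> D (y,z) \<longrightarrow> E (x,z)"
      using tr[OF E] by blast
    have "eventually (\<lambda>p. D p \<and> (case p of (x,y) \<Rightarrow> D (y,x))) \<U>"
      using D(1) sym[OF D(1)] by (rule eventually_conj)
    from nhd[OF this] obtain V where
      V: "\<And>x. x \<in> topspace Y \<Longrightarrow> openin Y (V x) \<and> x \<in> V x \<and> (\<forall>y\<in>V x. D (x,y) \<and> D (y,x))"
      by (auto, metis)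
    let ?W = "\<Union>x\<in>topspace Y. V x \<times> V x"
    have "openin (prod_topology Y Y) ?W"
      using V by (intro openin_Union) (auto simp: openin_prod_Times_iff)
    moreover have "\<forall>x\<in>topspace Y. (x,x) \<in> ?W" using V by blast
    moreover have "\<forall>p\<in>?W. E p" using V D(2) by fastforce
    ultimately show "\<exists>W. openin (prod_topology Y Y) W \<and> (\<forall>x\<in>topspace Y. (x,x) \<in> W) \<and> (\<forall>p\<in>W. E p)"
      by blast
  next
    assume "\<exists>W. openin (prod_topology Y Y) W \<and> (\<forall>x\<in>topspace Y. (x,x) \<in> W) \<and> (\<forall>p\<in>W. E p)"
    then obtain W where W: "openin (prod_topology Y Y) W" "\<forall>x\<in>topspace Y. (x,x) \<in> W" "\<forall>p\<in>W. E p"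
      by blast
    have "\<exists>A D V. (\<forall>a\<in>A. \<forall>b\<in>A. (a,b) \<in> W) \<and> eventually D \<U> \<and> openin Y V \<and> x \<in> V \<and> 
        (\<forall>a\<in>V. a \<in> A \<and> (\<forall>b. D (a,b) \<longrightarrow> b \<in> A))"
      if x: "x \<in> topspace Y" for x
    proof -
      obtain A B where AB: "openin Y A" "openin Y B" "x \<in> A" "x \<in> B" "A \<times> B \<subseteq> W"
        using W(1,2) x unfolding openin_prod_topology_alt by meson
      have "openin Y (A \<inter> B)" using AB by blast
      then have E: "eventually (\<lambda>(x',y). x' = x \<longrightarrow> y \<in> A \<inter> B) \<U>" using op AB by blast
      obtain D where D: "eventually D \<U>" "\<forall>u y z. D (u,y) \<longrightarrow> D (y,z) \<longrightarrow> (u = x \<longrightarrow> z \<in> A \<inter> B)"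
        using tr[OF E] by auto
      obtain V where V: "openin Y V" "x \<in> V" "\<forall>y\<in>V. D (x,y)" using nhd[OF D(1) x] by blast
      have "\<forall>a\<in>V. a \<in> A \<inter> B \<and> (\<forall>b. D (a,b) \<longrightarrow> b \<in> A \<inter> B)"
        using V D refl openin_subset[OF V(1)] by blast
      moreover have "\<forall>a\<in>A \<inter> B. \<forall>b\<in>A \<inter> B. (a,b) \<in> W" using AB(5) by blast
      ultimately show ?thesis
        using D(1) V(1,2) by (intro exI[of _ "A \<inter> B"] exI[of _ D] exI[of _ V] conjI)
    qed
    then obtain A D V where 
      A: "\<And>x. x \<in> topspace Y \<Longrightarrow> (\<forall>a\<in>A x. \<forall>b\<in>A x. (a,b) \<in> W) \<and> eventually (D x) \<U> \<and> openin Y (V x) \<and> x \<in> V x \<and> 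
        (\<forall>a\<in>V x. a \<in> A x \<and> (\<forall>b. D x (a,b) \<longrightarrow> b \<in> A x))"
      by metis
    obtain F where F: "finite F" "F \<subseteq> V ` topspace Y" "topspace Y \<subseteq> \<Union>F"
      using \<open>compact_space Y\<close> A unfolding compact_space_alt
      by (smt (verit, best) UN_I image_iff subset_eq)
    obtain I where I: "finite I" "I \<subseteq> topspace Y" "F = V ` I"
      using finite_subset_image[OF F(1,2)] by blast
    have "eventually (\<lambda>p. \<forall>i\<in>I. D i p) \<U>" 
      using I A by (simp add: eventually_ball_finite_distrib subset_iff)
    from eventually_conj[OF this S] show "eventually E \<U>"
    proof (rule eventually_mono, clarify)
      fix a b assume *: "\<forall>i\<in>I. D i (a,b)" "a \<in> topspace Y" "b \<in> topspace Y"
      obtain i where i: "i \<in> I" "a \<in> V i" using F I * by blast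
      then show "E (a,b)" using * A[of i] W I by blast
    qed
  qed
qed

lemma compatible_uniformity_exists:
  assumes cpt: "compact_space Y" and Haus: "Hausdorff_space Y"
  shows "\<exists>\<U>. compatible_uniformity Y \<U>"
proof -
  let ?S = "topspace Y"
  let ?P = "prod_topology Y Y"
  define B where "B = {W. openin ?P W \<and> (\<forall>x\<in>?S. (x,x) \<in> W)}"
  define \<U> where "\<U> = (INF W\<in>B. principal W)"
  have Binf: "\<And>V W. V \<in> B \<Longrightarrow> W \<in> B \<Longrightarrow> V \<inter> W \<in> B" unfolding B_def by blast
  have SB: "?S \<times> ?S \<in> B" by (simp add: B_def openin_prod_Times_iff)
  have ev: "eventually E \<U> \<longleftrightarrow> (\<exists>W\<in>B. \<forall>p\<in>W. E p)" for E
    unfolding \<U>_def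
  proof (subst eventually_INF_base)
    show "\<exists>x\<in>B. principal x \<le> inf (principal a) (principal b)" if "a \<in> B" "b \<in> B" for a b
      using Binf[OF that] by auto
  qed (use SB in \<open>auto simp: eventually_principal\<close>)
  have reg: "regular_space Y" using assms compact_Hausdorff_imp_regular_space by blast
  have "compatible_uniformity Y \<U>"
    unfolding compatible_uniformity_def
  proof (intro conjI allI impI)
    show "eventually (\<lambda>p. p \<in> ?S \<times> ?S) \<U>" unfolding ev using SB by blast
    show "\<forall>x\<in>?S. E (x,x)" if "eventually E \<U>" for E
      using that by (auto simp: ev B_def)
    show "eventually (\<lambda>(x,y). E (y,x)) \<U>" if E: "eventually E \<U>" for E
    proof -
      obtain W where W: "W \<in> B" "\<forall>p\<in>W. E p" using E unfolding ev by blast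
      let ?W = "{p \<in> topspace ?P. (snd p, fst p) \<in> W}"
      have "continuous_map ?P ?P (\<lambda>p. (snd p, fst p))"
        by (rule continuous_map_pairedI[OF continuous_map_snd continuous_map_fst])
      moreover have "openin ?P W" using W(1) unfolding B_def by blast
      ultimately have "openin ?P ?W" by (rule openin_continuous_map_preimage)
      then have "?W \<in> B" using W(1) by (auto simp: B_def)
      then show ?thesis unfolding ev by (rule bexI[rotated]) (use W(2) in auto)
    qed
    show "\<exists>D. eventually D \<U> \<and> (\<forall>x y z. D (x,y) \<longrightarrow> D (y,z) \<longrightarrow> E (x,z))" if E: "eventually E \<U>" for E
    proof -
      obtain W where W: "W \<in> B" "\<forall>p\<in>W. E p" using E unfolding ev by blast
      define K where "K = ?S \<times> ?S - W"
      have "openin ?P W" using W(1) unfolding B_def by blast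
      then have "closedin ?P (topspace ?P - W)" by (rule openin_closedin_eq[THEN iffD1, THEN conjunct2])
      then have "closedin ?P K" by (simp add: K_def)
      then have Kc: "compactin ?P K"
        using cpt by (simp add: closedin_compact_space compact_space_prod_topology)
      have "\<exists>A D. openin ?P A \<and> p \<in> A \<and> D \<in> B \<and> (\<forall>x y z. (x,y) \<in> D \<longrightarrow> (y,z) \<in> D \<longrightarrow> (x,z) \<notin> A)"
        if "p \<in> K" for p
      proof -
        obtain a c where p: "p = (a,c)" "a \<in> ?S" "c \<in> ?S" "a \<noteq> c" 
          using \<open>p \<in> K\<close> W(1) unfolding K_def B_def by blast
        obtain A C where AC: "openin Y A" "openin Y C" "a \<in> A" "c \<in> C" "A \<inter> C = {}"
          using Haus p unfolding Hausdorff_space_def disjnt_def by meson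
        have sep: "\<exists>A' D. openin Y A' \<and> a \<in> A' \<and> D \<in> B \<and> (\<forall>x y. ((x,y) \<in> D \<or> (y,x) \<in> D) \<longrightarrow> x \<in> A' \<longrightarrow> y \<in> A)"
          if A: "openin Y A" "a \<in> A" for A a
        proof -
          obtain A' F where A': "openin Y A'" "closedin Y F" "a \<in> A'" "A' \<subseteq> F" "F \<subseteq> A"
            using reg A unfolding neighbourhood_base_of_closedin[symmetric] neighbourhood_base_of by meson
          let ?D = "A \<times> A \<union> (?S - F) \<times> (?S - F)"
          have "openin Y (?S - F)" using A'(2) by blast
          then have "openin ?P ?D" using A(1) by (intro openin_Un) (auto simp: openin_prod_Times_iff)
          then have "?D \<in> B" using A' by (auto simp: B_def)
          then show ?thesis using A' by (intro exI[of _ A'] exI[of _ ?D]) blast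
        qed
        obtain A' D1 where 1: "openin Y A'" "a \<in> A'" "D1 \<in> B" "\<forall>x y. ((x,y) \<in> D1 \<or> (y,x) \<in> D1) \<longrightarrow> x \<in> A' \<longrightarrow> y \<in> A"
          using sep[of A a] AC by blast
        obtain C' D2 where 2: "openin Y C'" "c \<in> C'" "D2 \<in> B" "\<forall>x y. ((x,y) \<in> D2 \<or> (y,x) \<in> D2) \<longrightarrow> x \<in> C' \<longrightarrow> y \<in> C"
          using sep[of C c] AC by blast
        have "\<forall>x y z. (x,y) \<in> D1 \<inter> D2 \<longrightarrow> (y,z) \<in> D1 \<inter> D2 \<longrightarrow> (x,z) \<notin> A' \<times> C'"
          using 1 2 AC by blast
        moreover have "openin ?P (A' \<times> C')" "p \<in> A' \<times> C'" using 1 2 p by (auto simp: openin_prod_Times_iff)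
        ultimately show ?thesis using Binf[OF 1(3) 2(3)] by blast
      qed
      then obtain A D where A: "\<And>p. p \<in> K \<Longrightarrow> openin ?P (A p) \<and> p \<in> A p \<and> D p \<in> B \<and> (\<forall>x y z. (x,y) \<in> D p \<longrightarrow> (y,z) \<in> D p \<longrightarrow> (x,z) \<notin> A p)"
        by metis
      have "\<exists>F. finite F \<and> F \<subseteq> A ` K \<and> K \<subseteq> \<Union>F"
      proof -
        have "\<forall>U\<in>A ` K. openin ?P U" "K \<subseteq> \<Union>(A ` K)" using A by blast+
        then show ?thesis using Kc unfolding compactin_def by simp
      qed
      then obtain I where I: "finite I" "I \<subseteq> K" "K \<subseteq> \<Union>(A ` I)"
        by (metis finite_subset_image)
      have "finite I \<Longrightarrow> I \<subseteq> K \<Longrightarrow> ?S \<times> ?S \<inter> \<Inter>(D ` I) \<in> B" for I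
      proof (induction I rule: finite_induct)
        case (insert i I)
        then have "D i \<inter> (?S \<times> ?S \<inter> \<Inter>(D ` I)) \<in> B" using A Binf by blast
        then show ?case by (simp add: Int_left_commute)
      qed (use SB in simp)
      with I have D: "?S \<times> ?S \<inter> \<Inter>(D ` I) \<in> B" by blast
      let ?D = "\<lambda>p. p \<in> ?S \<times> ?S \<inter> \<Inter>(D ` I)"
      have "E (x,z)" if "?D (x,y)" "?D (y,z)" for x y z
      proof (rule ccontr)
        assume "\<not> E (x,z)"
        then have "(x,z) \<in> K" using W(2) that unfolding K_def by blast
        then obtain i where "i \<in> I" "(x,z) \<in> A i" using I by blast
        then show False using that A[of i] I(2) by blast
      qed
      moreover have "eventually ?D \<U>" unfolding ev using D by blast
      ultimately show ?thesis by blast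
    qed
    show "openin Y U \<longleftrightarrow> (\<forall>x\<in>U. eventually (\<lambda>(x',y). x' = x \<longrightarrow> y \<in> U) \<U>)" if US: "U \<subseteq> ?S" for U
    proof
      assume U: "openin Y U"
      show "\<forall>x\<in>U. eventually (\<lambda>(x',y). x' = x \<longrightarrow> y \<in> U) \<U>"
      proof
        fix x assume x: "x \<in> U"
        have "closedin Y {x}" using Haus x US by (simp add: closedin_Hausdorff_singleton subset_iff)
        then have "openin Y (?S - {x})" by blast
        then have "openin ?P (?S \<times> U \<union> (?S - {x}) \<times> ?S)"
          using U by (intro openin_Un) (simp_all add: openin_prod_Times_iff)
        then have "?S \<times> U \<union> (?S - {x}) \<times> ?S \<in> B"
          using x by (auto simp: B_def)
        then show "eventually (\<lambda>(x',y). x' = x \<longrightarrow> y \<in> U) \<U>"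
          unfolding ev by (rule bexI[rotated]) auto
      qed
    next
      assume *: "\<forall>x\<in>U. eventually (\<lambda>(x',y). x' = x \<longrightarrow> y \<in> U) \<U>"
      show "openin Y U"
      proof (subst openin_subopen, intro ballI)
        fix x assume x: "x \<in> U"
        obtain W where W: "W \<in> B" "\<forall>p\<in>W. case p of (x',y) \<Rightarrow> x' = x \<longrightarrow> y \<in> U"
          using * x unfolding ev by blast
        have "(x,x) \<in> W" "openin ?P W" using W(1) x US by (auto simp: B_def)
        then obtain A C where "openin Y A" "openin Y C" "x \<in> A" "x \<in> C" "A \<times> C \<subseteq> W"
          unfolding openin_prod_topology_alt by meson
        then show "\<exists>T. openin Y T \<and> x \<in> T \<and> T \<subseteq> U" using W(2) by blast
      qed
    qed
  qed
  then show ?thesis by blast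
qed

lemma compatible_uniformity_unique:
  assumes "compact_space Y" and "Hausdorff_space Y"
  shows "\<exists>!\<U>. compatible_uniformity Y \<U>"
proof (rule ex_ex1I)
  show "\<exists>\<U>. compatible_uniformity Y \<U>" using compatible_uniformity_exists assms by blast
  show "\<U> = \<V>" if "compatible_uniformity Y \<U>" "compatible_uniformity Y \<V>" for \<U> \<V>
    unfolding filter_eq_iff
    by (simp only: compatible_uniformity_diagonal[OF assms(1) that(1)]
        compatible_uniformity_diagonal[OF assms(1) that(2)] simp_thms)
qed

lemma eventually_uniformity_of:
  assumes "compact_space Y" and "Hausdorff_space Y"
  shows "eventually E (uniformity_of Y) \<longleftrightarrow>
    (\<exists>W. openin (prod_topology Y Y) W \<and> (\<forall>x\<in>topspace Y. (x,x) \<in> W) \<and> (\<forall>p\<in>W. E p))"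
proof -
  have "compatible_uniformity Y (uniformity_of Y)"
    unfolding uniformity_of_def by (rule theI'[OF compatible_uniformity_unique[OF assms]])
  from compatible_uniformity_diagonal[OF assms(1) this] show ?thesis .
qed


subsection \<open>Independence of the carrier types\<close>

lemma dense_image_copy:
  fixes \<nu> :: "'i \<Rightarrow> 'y"
  assumes Haus: "Hausdorff_space Y" and dense: "Y closure_of (\<nu> ` I) = topspace Y"
  obtains Y' :: "'i set set topology" and e e' where "homeomorphic_maps Y Y' e e'"
proof -
  define e where "e y = {{i \<in> I. \<nu> i \<in> U} | U. openin Y U \<and> y \<in> U}" for y
  have meets: "\<exists>i\<in>I. \<nu> i \<in> U" if "openin Y U" "y \<in> U" for U y
  proof -
    have "y \<in> Y closure_of (\<nu> ` I)" using that openin_subset dense by blast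
    then show ?thesis using that unfolding in_closure_of by blast
  qed
  have inj: "inj_on e (topspace Y)"
  proof (rule inj_onI, rule ccontr)
    fix y z assume yz: "y \<in> topspace Y" "z \<in> topspace Y" "e y = e z" "y \<noteq> z"
    then obtain U V where UV: "openin Y U" "openin Y V" "y \<in> U" "z \<in> V" "U \<inter> V = {}"
      using Haus unfolding Hausdorff_space_def disjnt_def by meson
    then have "{i \<in> I. \<nu> i \<in> U} \<in> e z" using yz(3) unfolding e_def by blast
    then obtain W where W: "openin Y W" "z \<in> W" "{i \<in> I. \<nu> i \<in> U} = {i \<in> I. \<nu> i \<in> W}"
      unfolding e_def by blast
    have "openin Y (V \<inter> W)" using UV W by blast
    then obtain i where "i \<in> I" "\<nu> i \<in> V \<inter> W" using meets[of "V \<inter> W" z] UV W by blast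
    then show False using W UV by blast
  qed
  define e' where "e' = inv_into (topspace Y) e"
  define Y' where "Y' = pullback_topology (e ` topspace Y) e' Y"
  have e': "e' (e y) = y" if "y \<in> topspace Y" for y using inj that by (simp add: e'_def)
  have ts: "topspace Y' = e ` topspace Y"
    by (auto simp: Y'_def topspace_pullback_topology e')
  have "continuous_map Y Y' e"
    unfolding Y'_def
    by (rule continuous_map_pullback') (auto simp: e' intro: continuous_map_eq[OF continuous_map_id])
  moreover have "continuous_map Y' Y e'"
    using continuous_map_pullback[OF continuous_map_id, of "e ` topspace Y" e' Y] unfolding Y'_def by simp
  ultimately have "homeomorphic_maps Y Y' e e'"
    unfolding homeomorphic_maps_def using ts e' by auto
  then show thesis by (rule that)
qed

context
  fixes Y :: "'y topology" and Y' :: "'z topology" and e e'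
  assumes hom: "homeomorphic_maps Y Y' e e'"
begin

definition transport_action :: "('g \<Rightarrow> 'y \<Rightarrow> 'y) \<Rightarrow> 'g \<Rightarrow> 'z \<Rightarrow> 'z" where
  "transport_action \<psi> g = (\<lambda>z\<in>topspace Y'. e (\<psi> g (e' z)))"

private lemma maps: "continuous_map Y Y' e" "continuous_map Y' Y e'"
  "\<And>y. y \<in> topspace Y \<Longrightarrow> e' (e y) = y" "\<And>z. z \<in> topspace Y' \<Longrightarrow> e (e' z) = z"
  "\<And>y. y \<in> topspace Y \<Longrightarrow> e y \<in> topspace Y'" "\<And>z. z \<in> topspace Y' \<Longrightarrow> e' z \<in> topspace Y"
  using hom continuous_map_funspace unfolding homeomorphic_maps_def by blast+

private lemma homeo: "Y homeomorphic_space Y'"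
  using hom homeomorphic_space_def by blast

lemma G_space_transport:
  assumes "G_space G T Y \<psi>"
  shows "G_space G T Y' (transport_action \<psi>)"
proof -
  from assms interpret group_action G "topspace Y" \<psi> unfolding G_space_def by blast
  have el: "\<psi> g y \<in> topspace Y" if "g \<in> carrier G" "y \<in> topspace Y" for g y
    using element_image that by blast
  have G: "group G" using group_hom group_hom.axioms(1) by blast
  have bij: "transport_action \<psi> g \<in> Bij (topspace Y')" if g: "g \<in> carrier G" for g
  proof -
    have "bij_betw (\<psi> g) (topspace Y) (topspace Y)"
      using bij_prop0[OF g] by (simp add: Bij_def)
    moreover have "bij_betw e (topspace Y) (topspace Y')" "bij_betw e' (topspace Y') (topspace Y)"
      using maps by (auto intro!: bij_betw_byWitness[of _ e' e] bij_betw_byWitness[of _ e e'])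
    ultimately have "bij_betw (e \<circ> (\<psi> g \<circ> e')) (topspace Y') (topspace Y')"
      by (meson bij_betw_trans)
    then have "bij_betw (transport_action \<psi> g) (topspace Y') (topspace Y')"
      by (rule bij_betw_cong[THEN iffD1, rotated]) (simp add: transport_action_def)
    then show ?thesis by (simp add: Bij_def transport_action_def)
  qed
  have "group_hom G (BijGroup (topspace Y')) (transport_action \<psi>)"
  proof (intro group_hom.intro G group_BijGroup group_hom_axioms.intro homI)
    fix g h assume gh: "g \<in> carrier G" "h \<in> carrier G"
    show "transport_action \<psi> g \<in> carrier (BijGroup (topspace Y'))"
      using bij[OF gh(1)] by (simp add: BijGroup_def)
    have "transport_action \<psi> (g \<otimes>\<^bsub>G\<^esub> h) = compose (topspace Y') (transport_action \<psi> g) (transport_action \<psi> h)"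
      using gh maps el composition_rule by (auto simp: transport_action_def compose_def fun_eq_iff)
    then show "transport_action \<psi> (g \<otimes>\<^bsub>G\<^esub> h) = transport_action \<psi> g \<otimes>\<^bsub>BijGroup (topspace Y')\<^esub> transport_action \<psi> h"
      using gh bij by (simp add: BijGroup_def)
  qed
  moreover have "continuous_map (prod_topology T Y') Y' (\<lambda>(g,z). transport_action \<psi> g z)"
  proof -
    have "continuous_map (prod_topology T Y') (prod_topology T Y) (\<lambda>p. (fst p, e' (snd p)))"
      by (rule continuous_map_pairedI[OF continuous_map_fst
            continuous_map_compose[OF continuous_map_snd maps(2), unfolded comp_def]])
    then have "continuous_map (prod_topology T Y') Y' (e \<circ> ((\<lambda>(g,y). \<psi> g y) \<circ> (\<lambda>p. (fst p, e' (snd p)))))"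
      using assms maps(1) unfolding G_space_def by (blast intro: continuous_map_compose)
    then show ?thesis
      by (rule continuous_map_eq) (auto simp: transport_action_def)
  qed
  ultimately show ?thesis
    using assms homeo unfolding G_space_def
    by (simp add: group_action_def homeomorphic_completely_regular_space homeomorphic_Hausdorff_space)
qed

lemma G_map_transport:
  assumes "G_space G T Y \<psi>"
  shows "G_map G Y \<psi> Y' (transport_action \<psi>) e" "G_map G Y' (transport_action \<psi>) Y \<psi> e'"
proof -
  from assms interpret group_action G "topspace Y" \<psi> unfolding G_space_def by blast
  have el: "\<psi> g y \<in> topspace Y" if "g \<in> carrier G" "y \<in> topspace Y" for g y
    using element_image that by blast
  show "G_map G Y \<psi> Y' (transport_action \<psi>) e" "G_map G Y' (transport_action \<psi>) Y \<psi> e'"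
    using maps el by (auto simp: G_map_def transport_action_def)
qed

lemma compact_G_space_transport:
  "compact_G_space G T Y \<psi> \<Longrightarrow> compact_G_space G T Y' (transport_action \<psi>)"
  using G_space_transport homeo homeomorphic_compact_space unfolding compact_G_space_def by blast

lemma minimal_flow_transport:
  assumes "minimal_flow G T Y \<psi>"
  shows "minimal_flow G T Y' (transport_action \<psi>)"
proof -
  have m: "compact_G_space G T Y \<psi>" "topspace Y \<noteq> {}"
    "\<And>y. y \<in> topspace Y \<Longrightarrow> Y closure_of (orbit G \<psi> y) = topspace Y"
    using assms unfolding minimal_flow_def by auto
  then have "G_space G T Y \<psi>" unfolding compact_G_space_def by blast
  then interpret group_action G "topspace Y" \<psi> unfolding G_space_def by blast
  have "Y' closure_of (orbit G (transport_action \<psi>) z) = topspace Y'" if z: "z \<in> topspace Y'" for z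
  proof -
    have "orbit G (transport_action \<psi>) z = e ` orbit G \<psi> (e' z)"
      using z by (auto simp: orbit_def transport_action_def)
    moreover have "orbit G \<psi> (e' z) \<subseteq> topspace Y"
      using element_image maps z unfolding orbit_def by blast
    moreover have "homeomorphic_map Y Y' e" using hom homeomorphic_maps_map by blast
    ultimately show ?thesis
      using homeomorphic_map_closure_of m(3) maps z homeomorphic_imp_surjective_map by metis
  qed
  then show ?thesis
    using compact_G_space_transport[OF m(1)] m(2) maps unfolding minimal_flow_def by blast
qed

lemma SUC_flow_transport:
  assumes "SUC_flow G T Y \<psi>"
  shows "SUC_flow G T Y' (transport_action \<psi>)"
proof -
  have c: "compact_G_space G T Y \<psi>" using assms unfolding SUC_flow_def by blast
  then have c': "compact_G_space G T Y' (transport_action \<psi>)" by (rule compact_G_space_transport)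
  from c interpret group_action G "topspace Y" \<psi> unfolding compact_G_space_def G_space_def by blast
  interpret group G using group_hom group_hom.axioms(1) by blast
  have ev: "eventually (\<lambda>(x,y). E (e x, e y)) (uniformity_of Y)" if E: "eventually E (uniformity_of Y')" for E
  proof -
    obtain W where W: "openin (prod_topology Y' Y') W" "\<forall>x\<in>topspace Y'. (x,x) \<in> W" "\<forall>p\<in>W. E p"
      using E c' eventually_uniformity_of[of Y'] unfolding compact_G_space_def G_space_def by auto
    let ?W = "{p \<in> topspace (prod_topology Y Y). (e (fst p), e (snd p)) \<in> W}"
    have "continuous_map (prod_topology Y Y) (prod_topology Y' Y') (\<lambda>p. (e (fst p), e (snd p)))"
      by (rule continuous_map_pairedI[OF
            continuous_map_compose[OF continuous_map_fst maps(1), unfolded comp_def]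
            continuous_map_compose[OF continuous_map_snd maps(1), unfolded comp_def]])
    then have "openin (prod_topology Y Y) ?W"
      using W(1) by (rule openin_continuous_map_preimage)
    moreover have "\<forall>x\<in>topspace Y. (x,x) \<in> ?W" using W(2) maps by simp
    moreover have "\<forall>p\<in>?W. case p of (x,y) \<Rightarrow> E (e x, e y)" using W(3) by auto
    ultimately show ?thesis
      using c eventually_uniformity_of[of Y] unfolding compact_G_space_def G_space_def by blast
  qed
  show ?thesis
    unfolding SUC_flow_def
  proof (intro conjI c' ballI allI impI)
    fix z E assume z: "z \<in> topspace Y'" and E: "eventually E (uniformity_of Y')"
    then obtain U where U: "openin T U" "\<one>\<^bsub>G\<^esub> \<in> U"
      "\<forall>g\<in>carrier G. \<forall>u\<in>U. E (e (\<psi> (g \<otimes>\<^bsub>G\<^esub> u) (e' z)), e (\<psi> g (e' z)))"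
    proof -
      have "\<exists>U. openin T U \<and> \<one>\<^bsub>G\<^esub> \<in> U \<and> (\<forall>g\<in>carrier G. \<forall>u\<in>U.
          (case (\<psi> (g \<otimes>\<^bsub>G\<^esub> u) (e' z), \<psi> g (e' z)) of (x,y) \<Rightarrow> E (e x, e y)))"
        using assms[unfolded SUC_flow_def, THEN conjunct2, rule_format, OF maps(6)[OF z] ev[OF E]] .
      then show thesis using that by auto
    qed
    then show "\<exists>U. openin T U \<and> \<one>\<^bsub>G\<^esub> \<in> U \<and> (\<forall>g\<in>carrier G. \<forall>u\<in>U.
        E (transport_action \<psi> (g \<otimes>\<^bsub>G\<^esub> u) z, transport_action \<psi> g z))"
      using z by (auto simp: transport_action_def)
  qed
qed

end

lemma G_map_compose:
  "G_map G X \<phi> Y \<psi> \<nu> \<Longrightarrow> G_map G Y \<psi> Z \<theta> \<mu> \<Longrightarrow> G_map G X \<phi> Z \<theta> (\<mu> \<circ> \<nu>)"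
  unfolding G_map_def using continuous_map_compose continuous_map_funspace by fastforce

lemma universal_minimal_flow_factor:
  fixes N :: "'n topology"
  assumes M: "universal_minimal_flow G T M \<phi>" and N: "minimal_flow G T N \<psi>"
  shows "\<exists>\<pi>. G_map G M \<phi> N \<psi> \<pi> \<and> \<pi> ` topspace M = topspace N"
proof -
  obtain y where y: "y \<in> topspace N" using N unfolding minimal_flow_def by blast
  have GN: "G_space G T N \<psi>" using N unfolding minimal_flow_def compact_G_space_def by blast
  have "orbit G \<psi> y = (\<lambda>g. \<psi> g y) ` carrier G" by (auto simp: orbit_def)
  then have "N closure_of ((\<lambda>g. \<psi> g y) ` carrier G) = topspace N"
    using N y unfolding minimal_flow_def by metis
  then obtain N' :: "'a set set topology" and e e' where h: "homeomorphic_maps N N' e e'"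
    using dense_image_copy GN unfolding G_space_def by metis
  obtain \<pi> where \<pi>: "G_map G M \<phi> N' (transport_action N' e e' \<psi>) \<pi>" "\<pi> ` topspace M = topspace N'"
    using M minimal_flow_transport[OF h N] unfolding universal_minimal_flow_def by blast
  have "(e' \<circ> \<pi>) ` topspace M = topspace N"
    using h \<pi>(2) by (metis homeomorphic_imp_surjective_map homeomorphic_maps_map image_comp)
  then show ?thesis using G_map_compose[OF \<pi>(1) G_map_transport(2)[OF h GN]] by blast
qed

lemma SUC_functionsI:
  fixes Y :: "'y topology" and X :: "'x topology"
  assumes Y: "SUC_flow G T Y \<psi>" and \<nu>: "G_map G X \<phi> Y \<psi> \<nu>"
    and dense: "Y closure_of (\<nu> ` topspace X) = topspace Y"
    and F: "continuous_map Y euclideanreal F" and f: "\<forall>x \<in> topspace X. f x = F (\<nu> x)"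
  shows "f \<in> SUC_functions G T X \<phi>"
proof -
  have GY: "G_space G T Y \<psi>" and cY: "compact_space Y"
    using Y unfolding SUC_flow_def compact_G_space_def by blast+
  obtain Y' :: "'x set set topology" and e e' where h: "homeomorphic_maps Y Y' e e'"
    using dense_image_copy dense GY unfolding G_space_def by metis
  have cont: "continuous_map X Y \<nu>" using \<nu> unfolding G_map_def by blast
  then have sub: "\<nu> ` topspace X \<subseteq> topspace Y" using continuous_map_image_subset_topspace by blast
  have "continuous_map X euclideanreal (F \<circ> \<nu>)" using cont F by (rule continuous_map_compose)
  then have 1: "continuous_map X euclideanreal f" by (rule continuous_map_eq) (simp add: f)
  have "compactin euclideanreal (F ` topspace Y)"
    using F cY image_compactin unfolding compact_space_def by blast
  then have "bounded (F ` topspace Y)" by (simp add: compact_imp_bounded)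
  then have 2: "bounded (f ` topspace X)" by (rule bounded_subset) (use f sub in auto)
  have hm: "homeomorphic_map Y Y' e" using h homeomorphic_maps_map by blast
  have 3: "Y' closure_of ((e \<circ> \<nu>) ` topspace X) = topspace Y'"
    using homeomorphic_map_closure_of[OF hm sub] dense homeomorphic_imp_surjective_map[OF hm]
    by (simp add: image_comp)
  have 4: "continuous_map Y' euclideanreal (F \<circ> e')"
    using h F unfolding homeomorphic_maps_def by (blast intro: continuous_map_compose)
  have 5: "\<forall>x \<in> topspace X. f x = (F \<circ> e') ((e \<circ> \<nu>) x)"
    using h f sub unfolding homeomorphic_maps_def by auto
  show ?thesis
    unfolding SUC_functions_def
    using 1 2 3 4 5 SUC_flow_transport[OF h Y] G_map_compose[OF \<nu> G_map_transport(1)[OF h GY]] by blast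
qed


subsection \<open>The homeomorphism group\<close>

lemma group_homeo_group: "group (homeo_group C)"
proof -
  let ?H = "{f \<in> Bij (mspace C). homeomorphic_map (mtopology_of C) (mtopology_of C) f}"
  have ts: "topspace (mtopology_of C) = mspace C" by simp
  interpret B: group "BijGroup (mspace C)" by (rule group_BijGroup)
  have "subgroup ?H (BijGroup (mspace C))"
  proof (rule B.subgroupI)
    show "?H \<subseteq> carrier (BijGroup (mspace C))" by (auto simp: BijGroup_def)
    have "homeomorphic_map (mtopology_of C) (mtopology_of C) (\<lambda>x\<in>mspace C. x)"
      by (rule homeomorphic_map_eq[of _ _ id]) auto
    then show "?H \<noteq> {}" using id_Bij by blast
  next
    fix f assume f: "f \<in> ?H"
    then have i: "inv\<^bsub>BijGroup (mspace C)\<^esub> f = (\<lambda>x\<in>mspace C. inv_into (mspace C) f x)"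
      by (simp add: inv_BijGroup)
    obtain g where g: "homeomorphic_maps (mtopology_of C) (mtopology_of C) f g"
      using f homeomorphic_map_maps by blast
    then have "homeomorphic_map (mtopology_of C) (mtopology_of C) g"
      using homeomorphic_maps_map by blast
    moreover have "g x = inv_into (mspace C) f x" if "x \<in> mspace C" for x
    proof -
      have "g x \<in> mspace C" "f (g x) = x"
        using g that continuous_map_funspace unfolding homeomorphic_maps_def ts by fastforce+
      moreover have "inj_on f (mspace C)" using f by (simp add: Bij_def bij_betw_def)
      ultimately show ?thesis by (metis inv_into_f_f)
    qed
    ultimately have "homeomorphic_map (mtopology_of C) (mtopology_of C) (\<lambda>x\<in>mspace C. inv_into (mspace C) f x)"
      by (auto intro: homeomorphic_map_eq)
    then show "inv\<^bsub>BijGroup (mspace C)\<^esub> f \<in> ?H"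
      unfolding i using f restrict_inv_into_Bij by blast
  next
    fix f g assume fg: "f \<in> ?H" "g \<in> ?H"
    then have "homeomorphic_map (mtopology_of C) (mtopology_of C) (f \<circ> g)"
      using homeomorphic_map_compose by blast
    then have "homeomorphic_map (mtopology_of C) (mtopology_of C) (compose (mspace C) f g)"
      by (rule homeomorphic_map_eq) (simp add: compose_def)
    then show "f \<otimes>\<^bsub>BijGroup (mspace C)\<^esub> g \<in> ?H"
      using fg by (simp add: BijGroup_def compose_Bij)
  qed
  then show ?thesis
    unfolding homeo_group_def by (rule B.subgroup_imp_group)
qed

lemma topspace_homeo_topology:
  assumes "compact_space (mtopology_of C)"
  shows "topspace (homeo_topology C) = carrier (homeo_group C)"
proof -
  interpret Metric_space "mspace C" "mdist C" by blast
  have "f \<in> mspace (cfunspace (mtopology_of C) C)" if f: "f \<in> carrier (homeo_group C)" for f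
  proof -
    have "f ` mspace C = mspace C" "f \<in> extensional (mspace C)"
      "continuous_map (mtopology_of C) (mtopology_of C) f"
      using f homeomorphic_imp_continuous_map
      by (auto simp: homeo_group_def Bij_def bij_betw_def)
    moreover have "mbounded (mspace C)"
      using assms compactin_imp_mbounded by (simp add: compact_space_def mtopology_of_def)
    ultimately show ?thesis by auto
  qed
  then show ?thesis by (auto simp: homeo_topology_def)
qed

end

theory Submission
  imports Defs
begin

text \<open>
  For a point \<open>y\<^sub>0\<close> of an SUC flow, the orbit map \<open>g \<mapsto> g y\<^sub>0\<close> is uniformly continuous for the left and
  the right uniformity of \<open>G\<close>, hence extends to the Roelcke compactification of \<open>G\<close>. For \<open>G = H(C)\<close>
  this compactification consists of closed relations on \<open>C\<close>, and \<open>C \<times> C\<close> is a fixed point of it,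
  so its image is a fixed point of the flow.

  The compactification can be avoided by choosing homeomorphisms \<open>h\<^sub>n\<close> whose graphs converge to
  \<open>C \<times> C\<close>. For every \<open>g\<close> and every neighbourhood \<open>U\<close> of the identity, \<open>g h\<^sub>n \<in> U h\<^sub>n U\<close> for
  all large \<open>n\<close>: if \<open>U\<close> is the stabiliser of a clopen partition \<open>(A\<^sub>i)\<close>, all the sets
  \<open>A\<^sub>i \<inter> h\<^sub>n A\<^sub>j\<close> and \<open>A\<^sub>i \<inter> g h\<^sub>n A\<^sub>j\<close> are nonempty and clopen, hence homeomorphic, and the
  homeomorphisms can be glued. Consequently every cluster point of \<open>h\<^sub>n y\<^sub>0\<close> is fixed by \<open>G\<close>.
  A minimal flow maps onto the SUC flow defining an SUC function, and the fibre over a fixed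
  point is closed and invariant, so the function is constant.
\<close>

section \<open>Fixed points of SUC flows\<close>

text \<open>Tube lemma: the open set \<open>?W\<close> contains the slice over the identity, so
  compactness of \<open>Y\<close> makes \<open>U\<close> independent of \<open>y\<close>.\<close>

lemma compact_G_space_equicontinuous:
  fixes f :: "'y \<Rightarrow> real"
  assumes Y: "compact_G_space G T Y \<psi>" and one: "\<one>\<^bsub>G\<^esub> \<in> topspace T"
    and f: "continuous_map Y euclideanreal f" and e: "0 < e"
  shows "\<exists>U. openin T U \<and> \<one>\<^bsub>G\<^esub> \<in> U \<and> (\<forall>u\<in>U. \<forall>y\<in>topspace Y. \<bar>f (\<psi> u y) - f y\<bar> < e)"
proof -
  from Y interpret group_action G "topspace Y" \<psi> unfolding compact_G_space_def G_space_def by blast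
  have cont: "continuous_map (prod_topology T Y) Y (\<lambda>(g, y). \<psi> g y)" and cpt: "compactin Y (topspace Y)"
    using Y unfolding compact_G_space_def G_space_def compact_space_def by blast+
  let ?d = "\<lambda>p. \<bar>f (\<psi> (fst p) (snd p)) - f (snd p)\<bar>"
  let ?W = "{p \<in> topspace (prod_topology T Y). ?d p \<in> {..<e}}"
  have "continuous_map (prod_topology T Y) euclideanreal ?d"
    using continuous_map_compose[OF cont f] continuous_map_compose[OF continuous_map_snd f]
    by (intro continuous_intros) (simp_all add: o_def case_prod_unfold)
  then have "openin (prod_topology T Y) ?W"
    by (rule openin_continuous_map_preimage) simp
  moreover have "\<psi> \<one>\<^bsub>G\<^esub> y = y" if "y \<in> topspace Y" for y
    using that by (simp flip: id_eq_one)
  then have "{\<one>\<^bsub>G\<^esub>} \<times> topspace Y \<subseteq> ?W" using one e by auto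
  ultimately obtain U V where "openin T U" "\<one>\<^bsub>G\<^esub> \<in> U" "topspace Y \<subseteq> V" "U \<times> V \<subseteq> ?W"
    using tube_lemma_right[OF _ cpt one] by meson
  then show ?thesis by fastforce
qed

text \<open>The SUC condition for the entourage that \<open>f\<close> pulls back from the real line.
  Here the perturbation acts before \<open>g\<close>, and the bound is uniform in \<open>g\<close>
  instead of in the point.\<close>

lemma SUC_flow_equicontinuous:
  fixes f :: "'y \<Rightarrow> real"
  assumes Y: "SUC_flow G T Y \<psi>" and y: "y \<in> topspace Y"
    and f: "continuous_map Y euclideanreal f" and e: "0 < e"
  shows "\<exists>U. openin T U \<and> \<one>\<^bsub>G\<^esub> \<in> U \<and>
    (\<forall>g\<in>carrier G. \<forall>u\<in>U. \<bar>f (\<psi> (g \<otimes>\<^bsub>G\<^esub> u) y) - f (\<psi> g y)\<bar> < e)"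
proof -
  let ?d = "\<lambda>p. \<bar>f (fst p) - f (snd p)\<bar>"
  let ?W = "{p \<in> topspace (prod_topology Y Y). ?d p \<in> {..<e}}"
  have "continuous_map (prod_topology Y Y) euclideanreal ?d"
    using continuous_map_compose[OF continuous_map_fst f] continuous_map_compose[OF continuous_map_snd f]
    by (intro continuous_intros) (simp_all add: o_def)
  then have "openin (prod_topology Y Y) ?W"
    by (rule openin_continuous_map_preimage) simp
  moreover have "\<forall>x\<in>topspace Y. (x, x) \<in> ?W" using e by simp
  ultimately have "eventually (\<lambda>p. ?d p < e) (uniformity_of Y)"
    using Y eventually_uniformity_of[of Y "\<lambda>p. ?d p < e"]
    unfolding SUC_flow_def compact_G_space_def G_space_def by fastforce
  then show ?thesis using Y y unfolding SUC_flow_def by fastforce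
qed

text \<open>The left factor \<open>u\<close> is absorbed by equicontinuity of the action on the
  compact space, the right factor \<open>w\<close> by the SUC condition at a base point
  \<open>y0\<close>. So \<open>g\<close> cannot move a cluster point of the points
  \<open>\<psi> (h n) y0\<close>.\<close>

lemma SUC_fppI:
  fixes G (structure) and h :: "nat \<Rightarrow> 'g"
  assumes T: "carrier G \<subseteq> topspace T" and h: "\<And>n. h n \<in> carrier G"
    and fac: "\<And>g U. g \<in> carrier G \<Longrightarrow> openin T U \<Longrightarrow> \<one> \<in> U \<Longrightarrow>
      \<forall>\<^sub>F n in sequentially. \<exists>u\<in>U \<inter> carrier G. \<exists>w\<in>U \<inter> carrier G. g \<otimes> h n = u \<otimes> h n \<otimes> w"
  shows "SUC_fpp G T TYPE('y)"
  unfolding SUC_fpp_def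
proof (intro allI impI, elim conjE)
  fix Y :: "'y topology" and \<psi>
  assume Y: "SUC_flow G T Y \<psi>" and ne: "topspace Y \<noteq> {}"
  then have cY: "compact_G_space G T Y \<psi>" and cpt: "compact_space Y" and Haus: "Hausdorff_space Y"
    and creg: "completely_regular_space Y"
    and cont: "continuous_map (prod_topology T Y) Y (\<lambda>(g, y). \<psi> g y)"
    unfolding SUC_flow_def compact_G_space_def G_space_def by blast+
  from cY interpret group_action G "topspace Y" \<psi> unfolding compact_G_space_def G_space_def by blast
  interpret group G using group_hom group_hom.axioms(1) by blast
  have one: "\<one> \<in> topspace T" using T by blast
  obtain y0 where y0: "y0 \<in> topspace Y" using ne by blast
  have act: "\<psi> g y \<in> topspace Y" if "g \<in> carrier G" "y \<in> topspace Y" for g y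
    using element_image that by blast
  \<comment> \<open>The closures of the tails are nested, so a common point \<open>y1\<close> is a
    cluster point of the sequence \<open>\<psi> (h n) y0\<close>.\<close>
  define K where "K n = Y closure_of ((\<lambda>m. \<psi> (h m) y0) ` {n..})" for n :: nat
  have "\<Inter> (range K) \<noteq> {}"
  proof (rule compact_space_imp_nest[OF cpt])
    show "closedin Y (K n)" for n by (simp add: K_def)
    show "K n \<noteq> {}" for n
      using closure_of_subset[of "(\<lambda>m. \<psi> (h m) y0) ` {n..}" Y] act h y0 unfolding K_def by fastforce
    show "antimono K" unfolding K_def by (intro antimonoI closure_of_mono image_mono) auto
  qed
  then obtain y1 where y1: "\<And>n. y1 \<in> K n" by blast
  then have y1Y: "y1 \<in> topspace Y" unfolding K_def by (meson closure_of_subset_topspace subsetD)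
  have "\<psi> g y1 = y1" if g: "g \<in> carrier G" for g
  proof (rule ccontr)
    assume "\<psi> g y1 \<noteq> y1"
    then have "closedin Y {\<psi> g y1}" "y1 \<in> topspace Y - {\<psi> g y1}"
      using Haus act[OF g y1Y] y1Y by (auto simp: closedin_Hausdorff_singleton)
    then obtain f where f: "continuous_map Y euclideanreal f" "f y1 = 0" "f (\<psi> g y1) = 1"
      using creg unfolding completely_regular_space_alt by (metis image_subset_iff insertI1 singletonD)
    obtain U1 where U1: "openin T U1" "\<one> \<in> U1" "\<forall>u\<in>U1. \<forall>y\<in>topspace Y. \<bar>f (\<psi> u y) - f y\<bar> < 1/4"
      using compact_G_space_equicontinuous[OF cY one f(1), of "1/4"] by auto
    obtain U2 where U2: "openin T U2" "\<one> \<in> U2"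
      "\<forall>g\<in>carrier G. \<forall>u\<in>U2. \<bar>f (\<psi> (g \<otimes> u) y0) - f (\<psi> g y0)\<bar> < 1/4"
      using SUC_flow_equicontinuous[OF Y y0 f(1), of "1/4"] by auto
    have "openin T (U1 \<inter> U2)" "\<one> \<in> U1 \<inter> U2" using U1 U2 by auto
    from fac[OF g this] obtain N where
      N: "\<forall>n\<ge>N. \<exists>u\<in>U1 \<inter> U2 \<inter> carrier G. \<exists>w\<in>U1 \<inter> U2 \<inter> carrier G. g \<otimes> h n = u \<otimes> h n \<otimes> w"
      unfolding eventually_sequentially by blast
    have "continuous_map Y (prod_topology T Y) (\<lambda>y. (g, y))"
      using g T by (intro continuous_map_pairedI) auto
    then have "continuous_map Y Y (\<psi> g)"
      using continuous_map_compose[OF _ cont, of Y "\<lambda>y. (g, y)"] by (simp add: o_def)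
    then have fg: "continuous_map Y euclideanreal (\<lambda>y. f (\<psi> g y))"
      using continuous_map_compose[OF _ f(1), of Y "\<psi> g"] by (simp add: o_def)
    \<comment> \<open>The difference is 1 at \<open>y1\<close>, so \<open>?V\<close> is a
      neighbourhood of the cluster point and contains some \<open>\<psi> (h n) y0\<close> with
      \<open>n \<ge> N\<close>. The two errors below 1/4 only allow a difference below 1/2.\<close>
    let ?V = "{y \<in> topspace Y. f (\<psi> g y) - f y \<in> {1/2<..}}"
    have "continuous_map Y euclideanreal (\<lambda>y. f (\<psi> g y) - f y)"
      using fg f(1) by (intro continuous_intros)
    then have "openin Y ?V" by (rule openin_continuous_map_preimage) simp
    moreover have "y1 \<in> ?V" using y1Y f by simp
    ultimately have "\<exists>z. z \<in> (\<lambda>m. \<psi> (h m) y0) ` {N..} \<and> z \<in> ?V"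
      by (intro y1[of N, unfolded K_def in_closure_of, THEN conjunct2, rule_format] conjI)
    then obtain n where n: "n \<ge> N" "\<psi> (h n) y0 \<in> ?V" by blast
    obtain u w where uw: "u \<in> U1" "w \<in> U2" "u \<in> carrier G" "w \<in> carrier G" "g \<otimes> h n = u \<otimes> h n \<otimes> w"
      using N n(1) by blast
    have "\<psi> g (\<psi> (h n) y0) = \<psi> u (\<psi> (h n \<otimes> w) y0)"
      using uw g h y0 by (simp add: composition_rule[symmetric] m_assoc)
    then have "\<bar>f (\<psi> g (\<psi> (h n) y0)) - f (\<psi> (h n \<otimes> w) y0)\<bar> < 1/4"
      using U1(3) uw act h y0 by simp
    moreover have "\<bar>f (\<psi> (h n \<otimes> w) y0) - f (\<psi> (h n) y0)\<bar> < 1/4" using U2(3) uw(2) h by blast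
    ultimately show False using n(2) by (simp add: abs_if split: if_splits)
  qed
  then show "\<exists>y\<in>topspace Y. \<forall>g\<in>carrier G. \<psi> g y = y" using y1Y by blast
qed

text \<open>The hypothesis names the type \<open>'x set set\<close> because the flows in
  \<open>SUC_functions\<close> live there.\<close>

lemma SUC_trivial_minimal_flow:
  fixes X :: "'x topology"
  assumes fpp: "SUC_fpp G T TYPE('x set set)" and X: "minimal_flow G T X \<phi>"
  shows "SUC_trivial G T X \<phi>"
  unfolding SUC_trivial_def
proof
  fix f assume "f \<in> SUC_functions G T X \<phi>"
  then obtain Y :: "'x set set topology" and \<psi> \<nu> F where Y: "SUC_flow G T Y \<psi>"
    and \<nu>: "G_map G X \<phi> Y \<psi> \<nu>" and dense: "Y closure_of (\<nu> ` topspace X) = topspace Y"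
    and F: "continuous_map Y euclideanreal F" "\<forall>x\<in>topspace X. f x = F (\<nu> x)"
    unfolding SUC_functions_def by blast
  from Y have Haus: "Hausdorff_space Y" unfolding SUC_flow_def compact_G_space_def G_space_def by blast
  from X have cpt: "compact_space X" and ne: "topspace X \<noteq> {}"
    and min: "\<And>x. x \<in> topspace X \<Longrightarrow> X closure_of (orbit G \<phi> x) = topspace X"
    unfolding minimal_flow_def compact_G_space_def by auto
  from \<nu> have cont: "continuous_map X Y \<nu>"
    and eq: "\<And>g x. g \<in> carrier G \<Longrightarrow> x \<in> topspace X \<Longrightarrow> \<nu> (\<phi> g x) = \<psi> g (\<nu> x)"
    unfolding G_map_def by auto
  \<comment> \<open>A compact image in a Hausdorff space is closed, so the dense image is all of
    \<open>Y\<close> and the fixed point has a preimage.\<close>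
  have "closedin Y (\<nu> ` topspace X)"
    using cpt cont Haus compactin_imp_closedin image_compactin unfolding compact_space_def by metis
  then have onto: "\<nu> ` topspace X = topspace Y" using dense closure_of_closedin by metis
  then obtain y where y: "y \<in> topspace Y" "\<And>g. g \<in> carrier G \<Longrightarrow> \<psi> g y = y"
    using fpp[unfolded SUC_fpp_def, rule_format, of Y \<psi>] Y ne by blast
  from y(1) obtain x where x: "x \<in> topspace X" "\<nu> x = y" unfolding onto[symmetric] by blast
  have "closedin Y {y}" using Haus y(1) by (simp add: closedin_Hausdorff_singleton)
  then have "closedin X {z \<in> topspace X. \<nu> z \<in> {y}}" using cont closedin_continuous_map_preimage by blast
  moreover have "group_action G (topspace X) \<phi>"
    using X unfolding minimal_flow_def compact_G_space_def G_space_def by blast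
  then have "\<phi> g x \<in> topspace X" if "g \<in> carrier G" for g
    using group_action.element_image[OF _ that x(1)] by blast
  then have "orbit G \<phi> x \<subseteq> {z \<in> topspace X. \<nu> z \<in> {y}}" using x y(2) eq by (auto simp: orbit_def)
  ultimately have "topspace X \<subseteq> {z \<in> topspace X. \<nu> z \<in> {y}}"
    using closure_of_minimal min[OF x(1)] by metis
  then have "\<forall>x\<in>topspace X. f x = F y" using F(2) by auto
  then show "\<exists>c. \<forall>x\<in>topspace X. f x = c" by blast
qed

section \<open>Homeomorphisms of the Cantor space\<close>

text \<open>The sets with a fixed label are open and partition the space, so maps given on them
  paste continuously. Keeping the label tells the inverse which piece to invert.\<close>

lemma homeomorphism_glue:
  fixes S :: "'a::topological_space set" and T :: "'b::topological_space set"
  assumes hom: "\<And>i. {x \<in> S. \<kappa> x = i} homeomorphic {y \<in> T. \<kappa>' y = i}"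
    and S: "\<And>i. openin (top_of_set S) {x \<in> S. \<kappa> x = i}"
    and T: "\<And>i. openin (top_of_set T) {y \<in> T. \<kappa>' y = i}"
  obtains u u' where "homeomorphism S T u u'" "\<And>x. x \<in> S \<Longrightarrow> \<kappa>' (u x) = \<kappa> x"
proof -
  obtain f f' where f: "\<And>i. homeomorphism {x \<in> S. \<kappa> x = i} {y \<in> T. \<kappa>' y = i} (f i) (f' i)"
    using hom unfolding homeomorphic_def by metis
  have glue: "continuous_on A (\<lambda>x. h (k x) x)"
    if "\<And>i. openin (top_of_set A) {x \<in> A. k x = i}" "\<And>i. continuous_on {x \<in> A. k x = i} (h i)"
    for A :: "'p::topological_space set" and h :: "'i \<Rightarrow> 'p \<Rightarrow> 'q::topological_space" and k
  proof -
    have "continuous_map (top_of_set A) euclidean (\<lambda>x. h (k x) x)"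
    proof (rule pasting_lemma[of UNIV _ "\<lambda>i. {x \<in> A. k x = i}" _ h])
      show "continuous_map (subtopology (top_of_set A) {x \<in> A. k x = i}) euclidean (h i)" for i
        using that(2)[of i] by (simp add: subtopology_subtopology Int_absorb1)
    qed (use that(1) in auto)
    then show ?thesis by simp
  qed
  have ff: "f (\<kappa> x) x \<in> T" "\<kappa>' (f (\<kappa> x) x) = \<kappa> x" "f' (\<kappa> x) (f (\<kappa> x) x) = x" if "x \<in> S" for x
    using f[of "\<kappa> x"] that unfolding homeomorphism_def by blast+
  have ff': "f' (\<kappa>' y) y \<in> S" "\<kappa> (f' (\<kappa>' y) y) = \<kappa>' y" "f (\<kappa>' y) (f' (\<kappa>' y) y) = y" if "y \<in> T" for y
    using f[of "\<kappa>' y"] that unfolding homeomorphism_def by blast+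
  have "homeomorphism S T (\<lambda>x. f (\<kappa> x) x) (\<lambda>y. f' (\<kappa>' y) y)"
  proof
    show "continuous_on S (\<lambda>x. f (\<kappa> x) x)"
      by (rule glue[OF S]) (use f in \<open>auto simp: homeomorphism_def\<close>)
    show "continuous_on T (\<lambda>y. f' (\<kappa>' y) y)"
      by (rule glue[OF T]) (use f in \<open>auto simp: homeomorphism_def\<close>)
  qed (use ff ff' in auto)
  then show thesis using ff(2) by (rule that)
qed

section \<open>Cylinders and uniform continuity\<close>

text \<open>For \<open>bool\<close> sequences the classes of \<open>agree n\<close> are the
  cylinders of length \<open>n\<close>; these relations form a base of the uniformity of the Cantor
  space and stand in for a metric.\<close>

definition agree :: "nat \<Rightarrow> (nat \<Rightarrow> 'a) \<Rightarrow> (nat \<Rightarrow> 'a) \<Rightarrow> bool" where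
  "agree n x y \<longleftrightarrow> (\<forall>k<n. x k = y k)"

lemma agree_refl [simp]: "agree n x x"
  and agree_sym: "agree n x y \<Longrightarrow> agree n y x"
  and agree_trans: "agree n x y \<Longrightarrow> agree n y z \<Longrightarrow> agree n x z"
  and agree_mono: "agree m x y \<Longrightarrow> n \<le> m \<Longrightarrow> agree n x y"
  by (auto simp: agree_def)

lemma open_agree: "open {y :: nat \<Rightarrow> bool. agree n x y}"
proof -
  have "open (\<Inter>k\<in>{..<n}. (\<lambda>y :: nat \<Rightarrow> bool. y k) -` {x k})"
    by (intro open_INT ballI open_vimage open_discrete continuous_on_product_coordinates) simp
  also have "(\<Inter>k\<in>{..<n}. (\<lambda>y. y k) -` {x k}) = {y. agree n x y}"
    by (auto simp: agree_def)
  finally show ?thesis .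
qed

lemma open_agree_invariant:
  fixes K :: "(nat \<Rightarrow> bool) set"
  assumes "\<And>x y. agree n x y \<Longrightarrow> x \<in> K \<Longrightarrow> y \<in> K"
  shows "open K"
proof (subst open_subopen, intro ballI exI conjI)
  fix x assume "x \<in> K"
  then show "{y. agree n x y} \<subseteq> K" using assms by blast
qed (simp_all add: open_agree)

lemma open_contains_agree:
  fixes U :: "(nat \<Rightarrow> bool) set"
  assumes "open U" "x \<in> U"
  shows "\<exists>n. \<forall>y. agree n x y \<longrightarrow> y \<in> U"
proof -
  have "openin (product_topology (\<lambda>_. euclidean) UNIV) U"
    using assms(1) by (simp add: euclidean_product_topology)
  from product_topology_open_contains_basis[OF this assms(2)] obtain X where
    X: "x \<in> (\<Pi>\<^sub>E i\<in>UNIV. X i)" "finite {i. X i \<noteq> UNIV}" "(\<Pi>\<^sub>E i\<in>UNIV. X i) \<subseteq> U" by auto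
  \<comment> \<open>A basic open box restricts finitely many coordinates; \<open>n\<close> bounds
    their indices.\<close>
  obtain n where n: "\<And>i. X i \<noteq> UNIV \<Longrightarrow> i < n"
    using X(2) unfolding finite_nat_set_iff_bounded by auto
  have "y \<in> U" if y: "agree n x y" for y
  proof -
    have "x i \<in> X i" for i using X(1) by (auto simp: PiE_iff)
    then have "y i \<in> X i" for i
      using n[of i] y by (cases "X i = UNIV") (simp, metis agree_def)
    then show ?thesis using X(3) by (auto simp: PiE_iff)
  qed
  then show ?thesis by blast
qed

lemma compact_cantor: "compact (UNIV :: (nat \<Rightarrow> bool) set)"
proof -
  have "compact_space (product_topology (\<lambda>_. euclidean :: bool topology) (UNIV :: nat set))"
    unfolding compact_space_product_topology by (simp add: compact_space_def finite_imp_compact)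
  then show ?thesis by (simp add: euclidean_product_topology compact_space_def)
qed

text \<open>Lebesgue number lemma: finitely many cylinders cover the space, and their greatest
  length works, since by transitivity points agreeing that far lie in a common one. A general
  \<open>R\<close> serves continuity and metric estimates alike.\<close>

lemma agree_lebesgue:
  assumes "\<And>x :: nat \<Rightarrow> bool. \<exists>U. open U \<and> x \<in> U \<and> (\<forall>y\<in>U. \<forall>z\<in>U. R y z)"
  shows "\<exists>n. \<forall>x y. agree n x y \<longrightarrow> R x y"
proof -
  have "\<exists>n. \<forall>y z. agree n x y \<longrightarrow> agree n x z \<longrightarrow> R y z" for x
    using assms[of x] open_contains_agree[of _ x] by metis
  then obtain N where N: "\<And>x y z. agree (N x) x y \<Longrightarrow> agree (N x) x z \<Longrightarrow> R y z" by metis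
  obtain I where I: "finite I" "UNIV \<subseteq> (\<Union>x\<in>I. {y. agree (N x) x y})"
  proof (rule compactE_image[OF compact_cantor])
    show "open {y. agree (N x) x y}" for x by (rule open_agree)
    show "UNIV \<subseteq> (\<Union>x\<in>UNIV. {y. agree (N x) x y})" by (auto intro: agree_refl)
  qed
  have "R y z" if yz: "agree (Max (N ` I)) y z" for y z
  proof -
    obtain x where x: "x \<in> I" "agree (N x) x y" using I(2) by blast
    then have "agree (N x) y z" using agree_mono[OF yz] I(1) by simp
    then show ?thesis using N x(2) agree_trans by blast
  qed
  then show ?thesis by blast
qed

lemma cantor_uniformly_continuous:
  fixes f :: "(nat \<Rightarrow> bool) \<Rightarrow> (nat \<Rightarrow> bool)"
  assumes "continuous_on UNIV f"
  shows "\<exists>m. \<forall>x y. agree m x y \<longrightarrow> agree n (f x) (f y)"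
proof (rule agree_lebesgue)
  fix x
  have "open (f -` {y. agree n (f x) y})" by (intro open_vimage open_agree assms)
  then show "\<exists>U. open U \<and> x \<in> U \<and> (\<forall>y\<in>U. \<forall>z\<in>U. agree n (f y) (f z))"
    by (intro exI[of _ "f -` {y. agree n (f x) y}"]) (auto intro: agree_sym agree_trans)
qed

section \<open>Nonempty clopen subsets of the Cantor space\<close>

text \<open>Deleting the first coordinate turns a condition on \<open>Suc n\<close> coordinates into
  one on \<open>n\<close>; this drives the induction below.\<close>

lemma homeomorphic_case_nat:
  fixes K :: "(nat \<Rightarrow> 'a::topological_space) set"
  shows "{x \<in> K. x 0 = b} homeomorphic {z. case_nat b z \<in> K}"
  unfolding homeomorphic_def
proof (intro exI homeomorphismI)
  show "continuous_on {x \<in> K. x 0 = b} (\<lambda>x k. x (Suc k))"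
    by (intro continuous_on_coordinatewise_then_product continuous_on_subset[OF continuous_on_product_coordinates]) simp
  show "continuous_on {z. case_nat b z \<in> K} (case_nat b)"
  proof (rule continuous_on_coordinatewise_then_product)
    show "continuous_on {z. case_nat b z \<in> K} (\<lambda>z. case_nat b z k)" for k
      by (cases k) (auto intro: continuous_on_subset[OF continuous_on_product_coordinates])
  qed
  have *: "case_nat (x 0) (\<lambda>k. x (Suc k)) = x" for x :: "nat \<Rightarrow> 'a"
    by (auto split: nat.split)
  then show "(\<lambda>x k. x (Suc k)) ` {x \<in> K. x 0 = b} \<subseteq> {z. case_nat b z \<in> K}"
    and "\<And>x. x \<in> {x \<in> K. x 0 = b} \<Longrightarrow> case_nat b (\<lambda>k. x (Suc k)) = x" by auto
qed auto

text \<open>\<open>K\<close> is a finite union of cylinders, hence clopen. After cutting it by the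
  first coordinate and deleting that coordinate, the induction hypothesis makes each nonempty half a
  Cantor space.\<close>

lemma agree_invariant_homeomorphic_UNIV:
  fixes K :: "(nat \<Rightarrow> bool) set"
  assumes "\<And>x y. agree n x y \<Longrightarrow> x \<in> K \<Longrightarrow> y \<in> K" and "K \<noteq> {}"
  shows "K homeomorphic (UNIV :: (nat \<Rightarrow> bool) set)"
  using assms
proof (induction n arbitrary: K)
  case 0
  then have "K = UNIV" by (auto simp: agree_def)
  then show ?case by (simp add: homeomorphic_refl)
next
  case (Suc n)
  have half: "{x \<in> K. x 0 = b} homeomorphic (UNIV :: (nat \<Rightarrow> bool) set)" if "{x \<in> K. x 0 = b} \<noteq> {}" for b
  proof -
    have "{z. case_nat b z \<in> K} homeomorphic (UNIV :: (nat \<Rightarrow> bool) set)"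
    proof (rule Suc.IH)
      show "y \<in> {z. case_nat b z \<in> K}" if "agree n x y" "x \<in> {z. case_nat b z \<in> K}" for x y
      proof -
        have "agree (Suc n) (case_nat b x) (case_nat b y)"
          using that(1) by (auto simp: agree_def split: nat.split)
        then show ?thesis using Suc.prems(1) that(2) by blast
      qed
      show "{z. case_nat b z \<in> K} \<noteq> {}"
        using that homeomorphic_case_nat[of K b] by (metis homeomorphic_empty(1))
    qed
    then show ?thesis using homeomorphic_case_nat homeomorphic_trans by blast
  qed
  show ?case
  \<comment> \<open>If one half is empty, \<open>K\<close> is the other half. Otherwise the two
    halves of \<open>K\<close> are matched with the two halves of the whole space and glued.\<close>
  proof (cases "\<exists>b. {x \<in> K. x 0 = b} = {}")
    case True
    then obtain b where "{x \<in> K. x 0 = b} = {}" by blast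
    then have "K = {x \<in> K. x 0 = (\<not> b)}" by auto
    then show ?thesis using half[of "\<not> b"] Suc.prems(2) by simp
  next
    case False
    have head: "openin (top_of_set S) {x \<in> S. x 0 = b}" for S :: "(nat \<Rightarrow> bool) set" and b
    proof -
      have "open ((\<lambda>x :: nat \<Rightarrow> bool. x 0) -` {b})"
        by (intro open_vimage open_discrete continuous_on_product_coordinates)
      then show ?thesis unfolding openin_open by (intro exI conjI) auto
    qed
    have "{x \<in> K. x 0 = b} homeomorphic {x \<in> (UNIV :: (nat \<Rightarrow> bool) set). x 0 = b}" for b
    proof -
      have 1: "{x \<in> (UNIV :: (nat \<Rightarrow> bool) set). x 0 = b} homeomorphic (UNIV :: (nat \<Rightarrow> bool) set)"
        using homeomorphic_case_nat[of UNIV b] by simp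
      have 2: "{x \<in> K. x 0 = b} homeomorphic (UNIV :: (nat \<Rightarrow> bool) set)"
        by (rule half) (use False in simp)
      show ?thesis by (rule homeomorphic_trans[OF 2 iffD1[OF homeomorphic_sym 1]])
    qed
    then obtain u u' where "homeomorphism K (UNIV :: (nat \<Rightarrow> bool) set) u u'"
      by (rule homeomorphism_glue[of K "\<lambda>x. x 0" UNIV "\<lambda>x. x 0", OF _ head head])
    then show ?thesis unfolding homeomorphic_def by blast
  qed
qed

text \<open>Equal ranges make a fibre of \<open>\<kappa>\<close> empty exactly when the
  corresponding fibre of \<open>\<kappa>'\<close> is. Nonempty fibres are Cantor spaces, so the
  fibres are homeomorphic in pairs and can be glued.\<close>

lemma homeomorphism_same_fibres:
  fixes \<kappa> \<kappa>' :: "(nat \<Rightarrow> bool) \<Rightarrow> 'i"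
  assumes \<kappa>: "\<And>x y. agree n x y \<Longrightarrow> \<kappa> x = \<kappa> y" and \<kappa>': "\<And>x y. agree n x y \<Longrightarrow> \<kappa>' x = \<kappa>' y"
    and range: "range \<kappa> = range \<kappa>'"
  obtains u u' where "homeomorphism UNIV UNIV u u'" "\<And>x. \<kappa>' (u x) = \<kappa> x"
proof -
  have "{x \<in> UNIV. \<kappa> x = i} homeomorphic {x \<in> UNIV. \<kappa>' x = i}" for i
  proof (cases "i \<in> range \<kappa>")
    case True
    have "{x. \<kappa> x = i} homeomorphic (UNIV :: (nat \<Rightarrow> bool) set)"
      by (rule agree_invariant_homeomorphic_UNIV[of n]) (use True \<kappa> in auto)
    moreover have "{x. \<kappa>' x = i} homeomorphic (UNIV :: (nat \<Rightarrow> bool) set)"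
      by (rule agree_invariant_homeomorphic_UNIV[of n]) (use True \<kappa>' range in auto)
    ultimately show ?thesis by (simp, metis homeomorphic_sym homeomorphic_trans)
  next
    case False
    then have "{x. \<kappa> x = i} = {}" "{x. \<kappa>' x = i} = {}" using range by auto
    then show ?thesis by simp
  qed
  moreover have "openin (top_of_set UNIV) {x \<in> UNIV. \<kappa> x = i}"
    "openin (top_of_set UNIV) {x \<in> UNIV. \<kappa>' x = i}" for i
    using \<kappa> \<kappa>' by (auto intro!: open_agree_invariant[of n] simp flip: open_openin)
  ultimately show thesis
    by (rule homeomorphism_glue[of UNIV \<kappa> UNIV \<kappa>']) (rule that, auto)
qed

section \<open>Block swaps and the factorization\<close>

text \<open>These serve as the homeomorphisms \<open>h\<^sub>n\<close> whose graphs converge to the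
  full square; being involutions, they are their own inverses.\<close>

definition swap_blocks :: "nat \<Rightarrow> (nat \<Rightarrow> 'a) \<Rightarrow> nat \<Rightarrow> 'a" where
  "swap_blocks n x k = (if k < n then x (k + n) else if k < 2 * n then x (k - n) else x k)"

lemma swap_blocks_swap_blocks [simp]: "swap_blocks n (swap_blocks n x) = x"
  by (auto simp: swap_blocks_def fun_eq_iff)

lemma homeomorphism_swap_blocks:
  "homeomorphism UNIV UNIV (swap_blocks n) (swap_blocks n :: (nat \<Rightarrow> 'a::topological_space) \<Rightarrow> _)"
proof -
  have "continuous_on UNIV (\<lambda>x :: nat \<Rightarrow> 'a. swap_blocks n x k)" for k
    unfolding swap_blocks_def by (cases "k < n"; cases "k < 2 * n") simp_all
  then have "continuous_on UNIV (swap_blocks n :: (nat \<Rightarrow> 'a) \<Rightarrow> _)"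
    by (rule continuous_on_coordinatewise_then_product)
  then show ?thesis by (intro homeomorphismI) auto
qed

text \<open>Input and output are prescribed on disjoint coordinates: the first block of
  \<open>x\<close> comes from \<open>a\<close>; the second block, which becomes the first block of
  the image, comes from \<open>b\<close>. So the graph meets every product of two cylinders of
  length \<open>n\<close>.\<close>

lemma swap_blocks_mixing: "\<exists>x. agree n a x \<and> agree n b (swap_blocks n x)"
  by (rule exI[of _ "\<lambda>k. if k < n then a k else b (k - n)"]) (simp add: agree_def swap_blocks_def)

text \<open>The equation determines \<open>w\<close> from \<open>u\<close>, so only \<open>u\<close>
  is constructed. It carries the labels \<open>\<kappa>\<close> to \<open>\<kappa>'\<close>: their
  first components keep \<open>u\<close> close to the identity, their second components keep
  \<open>w\<close> close to it.\<close>

lemma swap_blocks_factorization: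
  fixes g g' :: "(nat \<Rightarrow> bool) \<Rightarrow> (nat \<Rightarrow> bool)"
  assumes g: "homeomorphism UNIV UNIV g g'"
  shows "\<forall>\<^sub>F n in sequentially. \<exists>u u' w w'.
    homeomorphism UNIV UNIV u u' \<and> homeomorphism UNIV UNIV w w' \<and>
    (\<forall>x. agree m (u x) x) \<and> (\<forall>x. agree m (w x) x) \<and> g \<circ> swap_blocks n = u \<circ> swap_blocks n \<circ> w"
proof -
  have gg: "continuous_on UNIV g" "continuous_on UNIV g'" "\<And>x. g' (g x) = x" "\<And>x. g (g' x) = x"
    using g by (auto simp: homeomorphism_def)
  \<comment> \<open>For \<open>n \<ge> k\<close>, agreement on \<open>n\<close> coordinates survives
    the map \<open>g\<close> as agreement on \<open>m\<close>, so mixing passes from the swap to its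
    composition with \<open>g\<close>.\<close>
  obtain k where k: "\<And>x y. agree k x y \<Longrightarrow> agree m (g x) (g y)"
    using cantor_uniformly_continuous[OF gg(1)] by blast
  show ?thesis
  proof (rule eventually_sequentiallyI[of "max k m"])
    fix n assume n: "max k m \<le> n"
    let ?s = "swap_blocks n :: (nat \<Rightarrow> bool) \<Rightarrow> _"
    have s: "homeomorphism UNIV UNIV ?s ?s" by (rule homeomorphism_swap_blocks)
    then have sc: "continuous_on UNIV ?s" by (simp add: homeomorphism_def)
    \<comment> \<open>The fibres of \<open>\<kappa>\<close> are the sets \<open>A\<^sub>i \<inter> h\<^sub>n A\<^sub>j\<close>, those of \<open>\<kappa>'\<close> the sets
      \<open>A\<^sub>i \<inter> g h\<^sub>n A\<^sub>j\<close>, where \<open>h\<^sub>n = ?s\<close> is an involution and the \<open>A\<^sub>i\<close> are the cylinders of length \<open>m\<close>.\<close>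
    define \<kappa> where "\<kappa> x = (map x [0..<m], map (?s x) [0..<m])" for x
    define \<kappa>' where "\<kappa>' x = (map x [0..<m], map (?s (g' x)) [0..<m])" for x
    have map_eq: "map x [0..<m] = map y [0..<m] \<longleftrightarrow> agree m x y" for x y :: "nat \<Rightarrow> bool"
      by (auto simp: agree_def)
    have "continuous_on UNIV (?s \<circ> g')"
      using gg(2) sc continuous_on_compose continuous_on_subset by blast
    then obtain l l' where l: "\<And>x y. agree l x y \<Longrightarrow> agree m (?s x) (?s y)"
      and l': "\<And>x y. agree l' x y \<Longrightarrow> agree m (?s (g' x)) (?s (g' y))"
      using cantor_uniformly_continuous[of _ m] sc by (metis comp_apply)
    \<comment> \<open>Both labels depend on the first \<open>?N\<close> coordinates only:
      \<open>m\<close> covers the first components, \<open>l\<close> and \<open>l'\<close> the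
      second ones.\<close>
    let ?N = "max m (max l l')"
    have inv: "\<kappa> x = \<kappa> y" "\<kappa>' x = \<kappa>' y" if "agree ?N x y" for x y
      unfolding \<kappa>_def \<kappa>'_def prod.inject map_eq by (simp_all add: l l' agree_mono[OF that])
    have "\<exists>y. \<kappa>' y = \<kappa> x" for x
    proof -
      \<comment> \<open>For \<open>y = g (?s z)\<close> the label \<open>\<kappa>' y\<close>
        involves \<open>y\<close> and \<open>?s (g' y) = z\<close>. So \<open>z\<close> has to agree
        with \<open>?s x\<close>, and \<open>?s z\<close> with \<open>g' x\<close> far enough for
        \<open>y\<close> to agree with \<open>x\<close>.\<close>
      obtain z where z: "agree n (?s x) z" "agree n (g' x) (?s z)"
        using swap_blocks_mixing by blast
      have "agree m x (g (?s z))" using k[OF agree_mono[OF z(2)]] n by (simp add: gg)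
      moreover have "agree m (?s x) z" using z(1) n by (auto intro: agree_mono)
      ultimately show ?thesis
        by (intro exI[of _ "g (?s z)"]) (auto simp: \<kappa>_def \<kappa>'_def gg agree_def)
    qed
    moreover have "\<exists>x. \<kappa> x = \<kappa>' y" for y
    proof -
      obtain x where x: "agree n y x" "agree n (?s (g' y)) (?s x)"
        using swap_blocks_mixing by blast
      then show ?thesis using n
        by (intro exI[of _ x]) (auto simp: \<kappa>_def \<kappa>'_def agree_def)
    qed
    ultimately have "range \<kappa> = range \<kappa>'" by (intro equalityI image_subsetI) (metis rangeI)+
    from homeomorphism_same_fibres[OF inv this] obtain u u' where
      u: "homeomorphism UNIV UNIV u u'" "\<And>x. \<kappa>' (u x) = \<kappa> x" by blast
    have au: "agree m (u x) x" "agree m (?s (g' (u x))) (?s x)" for x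
      using u(2)[of x] unfolding \<kappa>_def \<kappa>'_def prod.inject map_eq by auto
    have uu: "\<And>x. u' (u x) = x" "\<And>x. u (u' x) = x" using u(1) by (auto simp: homeomorphism_def)
    let ?w = "?s \<circ> (u' \<circ> (g \<circ> ?s))"
    have "homeomorphism UNIV UNIV (g \<circ> ?s) (?s \<circ> g')"
      by (rule homeomorphism_compose[OF s g])
    then have "homeomorphism UNIV UNIV (u' \<circ> (g \<circ> ?s)) ((?s \<circ> g') \<circ> u)"
      using homeomorphism_symD[OF u(1)] by (rule homeomorphism_compose)
    then have "homeomorphism UNIV UNIV ?w (((?s \<circ> g') \<circ> u) \<circ> ?s)"
      using s by (rule homeomorphism_compose)
    \<comment> \<open>The second label components control the inverse of \<open>?w\<close>;
      evaluating at \<open>u' (g (?s x))\<close> and using symmetry gives control of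
      \<open>?w\<close> itself.\<close>
    moreover have "agree m (?w x) x" for x
      using agree_sym[OF au(2)[of "u' (g (?s x))"]] by (simp add: uu gg)
    moreover have "g \<circ> ?s = u \<circ> ?s \<circ> ?w" by (simp add: fun_eq_iff uu)
    ultimately show "\<exists>u u' w w'. homeomorphism UNIV UNIV u u' \<and> homeomorphism UNIV UNIV w w' \<and>
        (\<forall>x. agree m (u x) x) \<and> (\<forall>x. agree m (w x) x) \<and> g \<circ> ?s = u \<circ> ?s \<circ> w"
      using u(1) au(1) by blast
  qed
qed

section \<open>The homeomorphism group of a metric Cantor set\<close>

lemma cantor_topology_euclidean: "cantor_topology = euclidean"
proof -
  have "discrete_topology UNIV = (euclidean :: bool topology)"
    by (simp add: topology_eq open_discrete flip: open_openin)
  then show ?thesis by (simp add: cantor_topology_def euclidean_product_topology)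
qed

context
  fixes C :: "'c metric" and \<Phi> :: "'c \<Rightarrow> nat \<Rightarrow> bool" and \<Psi>
  assumes coord: "homeomorphic_maps (mtopology_of C) euclidean \<Phi> \<Psi>"
begin

private lemma coordinates:
  "continuous_map (mtopology_of C) euclidean \<Phi>" "continuous_map euclidean (mtopology_of C) \<Psi>"
  "\<And>x. x \<in> mspace C \<Longrightarrow> \<Psi> (\<Phi> x) = x" "\<And>z. \<Phi> (\<Psi> z) = z" "\<And>z. \<Psi> z \<in> mspace C"
  using coord continuous_map_image_subset_topspace[of euclidean "mtopology_of C" \<Psi>]
  by (auto simp: homeomorphic_maps_def)

text \<open>Conjugation by the coordinates, restricted to \<open>mspace C\<close> because members of
  \<open>Bij\<close> are extensional.\<close>

private definition lift_homeo :: "((nat \<Rightarrow> bool) \<Rightarrow> nat \<Rightarrow> bool) \<Rightarrow> 'c \<Rightarrow> 'c" where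
  "lift_homeo u = (\<lambda>x\<in>mspace C. \<Psi> (u (\<Phi> x)))"

private lemma continuous_map_lift_homeo:
  assumes "continuous_on UNIV u"
  shows "continuous_map (mtopology_of C) (mtopology_of C) (lift_homeo u)"
proof -
  have "continuous_map (mtopology_of C) (mtopology_of C) (\<Psi> \<circ> (u \<circ> \<Phi>))"
    using assms coordinates(1,2) by (intro continuous_map_compose) auto
  then show ?thesis by (rule continuous_map_eq) (simp add: lift_homeo_def)
qed

private lemma lift_homeo_carrier:
  assumes "homeomorphism UNIV UNIV u u'"
  shows "lift_homeo u \<in> carrier (homeo_group C)"
proof -
  have u: "continuous_on UNIV u" "continuous_on UNIV u'" "\<And>x. u' (u x) = x" "\<And>x. u (u' x) = x"
    using assms by (auto simp: homeomorphism_def)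
  have inv: "lift_homeo u' (lift_homeo u x) = x" "lift_homeo u (lift_homeo u' x) = x"
    if "x \<in> mspace C" for x
    using that by (simp_all add: lift_homeo_def coordinates u)
  then have "homeomorphic_maps (mtopology_of C) (mtopology_of C) (lift_homeo u) (lift_homeo u')"
    unfolding homeomorphic_maps_def by (simp add: continuous_map_lift_homeo u)
  moreover have "bij_betw (lift_homeo u) (mspace C) (mspace C)"
    by (rule bij_betw_byWitness[of _ "lift_homeo u'"]) (use inv in \<open>auto simp: lift_homeo_def coordinates\<close>)
  ultimately show ?thesis
    by (auto simp: homeo_group_def Bij_def lift_homeo_def dest: homeomorphic_maps_map[THEN iffD1])
qed

private lemma lift_homeo_mult:
  assumes "homeomorphism UNIV UNIV u u'" "homeomorphism UNIV UNIV v v'"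
  shows "lift_homeo u \<otimes>\<^bsub>homeo_group C\<^esub> lift_homeo v = lift_homeo (u \<circ> v)"
proof -
  have "lift_homeo u \<in> Bij (mspace C)" "lift_homeo v \<in> Bij (mspace C)"
    using lift_homeo_carrier assms by (auto simp: homeo_group_def)
  then show ?thesis
    by (auto simp: homeo_group_def BijGroup_def compose_def lift_homeo_def coordinates fun_eq_iff)
qed

private lemma carrier_lift_homeo:
  assumes "g \<in> carrier (homeo_group C)"
  obtains u u' where "homeomorphism UNIV UNIV u u'" "g = lift_homeo u"
proof -
  have g: "g \<in> extensional (mspace C)" "homeomorphic_map (mtopology_of C) (mtopology_of C) g"
    using assms by (auto simp: homeo_group_def Bij_def)
  then obtain g' where g': "homeomorphic_maps (mtopology_of C) (mtopology_of C) g g'"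
    using homeomorphic_map_maps by blast
  then have c: "continuous_map (mtopology_of C) (mtopology_of C) g" "continuous_map (mtopology_of C) (mtopology_of C) g'"
    and i: "\<And>x. x \<in> mspace C \<Longrightarrow> g' (g x) = x" "\<And>x. x \<in> mspace C \<Longrightarrow> g (g' x) = x"
    by (auto simp: homeomorphic_maps_def)
  have m: "g x \<in> mspace C" "g' x \<in> mspace C" if "x \<in> mspace C" for x
    using c that continuous_map_image_subset_topspace by fastforce+
  have cont: "continuous_on UNIV (\<Phi> \<circ> (f \<circ> \<Psi>))"
    if "continuous_map (mtopology_of C) (mtopology_of C) f" for f
    using continuous_map_compose[OF continuous_map_compose[OF coordinates(2) that] coordinates(1)] by simp
  have "homeomorphism UNIV UNIV (\<Phi> \<circ> (g \<circ> \<Psi>)) (\<Phi> \<circ> (g' \<circ> \<Psi>))"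
    by (intro homeomorphismI cont c) (simp_all add: coordinates m i)
  moreover have "g = lift_homeo (\<Phi> \<circ> (g \<circ> \<Psi>))"
    using g(1) by (auto simp: lift_homeo_def coordinates m extensional_def fun_eq_iff)
  ultimately show thesis by (rule that)
qed

private lemma topspace_homeo_topology': "topspace (homeo_topology C) = carrier (homeo_group C)"
proof (rule topspace_homeo_topology)
  have "mtopology_of C homeomorphic_space (euclidean :: (nat \<Rightarrow> bool) topology)"
    using coord homeomorphic_space_def by blast
  moreover have "compact_space (euclidean :: (nat \<Rightarrow> bool) topology)"
    using compact_cantor by (simp add: compact_space_def)
  ultimately show "compact_space (mtopology_of C)"
    using homeomorphic_compact_space by blast
qed

text \<open>Uniform continuity of \<open>\<Psi>\<close> turns agreement on \<open>m\<close>
  coordinates into closeness in \<open>C\<close>, uniformly over all points, which is what the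
  supremum metric measures.\<close>

private lemma lift_homeo_near_one:
  assumes U: "openin (homeo_topology C) U" "\<one>\<^bsub>homeo_group C\<^esub> \<in> U"
  shows "\<exists>m. \<forall>u u'. homeomorphism UNIV UNIV u u' \<longrightarrow> (\<forall>x. agree m (u x) x) \<longrightarrow> lift_homeo u \<in> U"
proof -
  let ?F = "cfunspace (mtopology_of C) C"
  have one: "\<one>\<^bsub>homeo_group C\<^esub> = lift_homeo id"
    by (auto simp: homeo_group_def BijGroup_def lift_homeo_def coordinates)
  obtain V where V: "openin (mtopology_of ?F) V" "U = V \<inter> carrier (homeo_group C)"
    using U(1) unfolding homeo_topology_def openin_subtopology by blast
  interpret F: Metric_space "mspace ?F" "mdist ?F" by blast
  have id: "lift_homeo id \<in> V" using U(2) V(2) one by simp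
  have "openin F.mtopology V" using V(1) by (simp only: mtopology_of_def)
  from F.openin_mtopology[THEN iffD1, OF this, THEN conjunct2, rule_format, OF id]
  obtain r where r: "r > 0" "F.mball (lift_homeo id) r \<subseteq> V" by blast
  \<comment> \<open>A supremum of distances below \<open>r/2\<close> is at most \<open>r/2\<close>,
    hence below \<open>r\<close>. Balls of radius \<open>r/4\<close> yield the bound by the triangle
    inequality.\<close>
  have "\<exists>m. \<forall>x y. agree m x y \<longrightarrow> mdist C (\<Psi> x) (\<Psi> y) < r/2"
  proof (rule agree_lebesgue)
    fix x
    let ?B = "mball_of C (\<Psi> x) (r/4)"
    have zero: "mdist C (\<Psi> x) (\<Psi> x) = 0" by (simp add: coordinates)
    have "openin (mtopology_of C) ?B"
      by (simp add: mtopology_of_def mball_of_def Metric_space.openin_mball)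
    then have "openin euclidean {y \<in> topspace euclidean. \<Psi> y \<in> ?B}"
      by (rule openin_continuous_map_preimage[OF coordinates(2)])
    then have "open {y. \<Psi> y \<in> ?B}" by simp
    moreover have "mdist C (\<Psi> y) (\<Psi> z) < r/2" if "\<Psi> y \<in> ?B" "\<Psi> z \<in> ?B" for y z
    proof -
      have "mdist C (\<Psi> y) (\<Psi> z) \<le> mdist C (\<Psi> y) (\<Psi> x) + mdist C (\<Psi> x) (\<Psi> z)"
        by (simp add: mdist_triangle coordinates)
      then show ?thesis using that by (simp add: mdist_commute)
    qed
    moreover have "mdist C (\<Psi> x) (\<Psi> x) < r/4" unfolding zero using r(1) by simp
    ultimately show "\<exists>U. open U \<and> x \<in> U \<and> (\<forall>y\<in>U. \<forall>z\<in>U. mdist C (\<Psi> y) (\<Psi> z) < r/2)"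
      using r(1) by (intro exI[of _ "{y. \<Psi> y \<in> ?B}"]) (simp add: coordinates)
  qed
  then obtain m where m: "\<And>x y. agree m x y \<Longrightarrow> mdist C (\<Psi> x) (\<Psi> y) < r/2" by blast
  have "lift_homeo u \<in> U" if u: "homeomorphism UNIV UNIV u u'" "\<forall>x. agree m (u x) x" for u u'
  proof -
    have mem: "lift_homeo u \<in> mspace ?F" "lift_homeo id \<in> mspace ?F"
      using lift_homeo_carrier[OF u(1)] lift_homeo_carrier[of id id] topspace_homeo_topology'
      unfolding homeo_topology_def by (auto simp: homeomorphism_def simp del: mspace_cfunspace)
    have "mdist C (\<Psi> z) (\<Psi> (u z)) \<le> r/2" for z
      using m[OF agree_sym] u(2) by (simp add: less_imp_le)
    then have "mdist ?F (lift_homeo id) (lift_homeo u) \<le> r/2"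
      by (intro mdist_cfunspace_le) (use r(1) in \<open>auto simp: lift_homeo_def\<close>)
    then have "lift_homeo u \<in> F.mball (lift_homeo id) r"
      using mem r(1) by (simp add: F.in_mball del: mspace_cfunspace)
    then show ?thesis using r(2) V(2) lift_homeo_carrier[OF u(1)] by blast
  qed
  then show ?thesis by blast
qed

lemma SUC_fpp_homeo_group: "SUC_fpp (homeo_group C) (homeo_topology C) TYPE('y)"
proof (rule SUC_fppI)
  show "carrier (homeo_group C) \<subseteq> topspace (homeo_topology C)"
    by (simp add: topspace_homeo_topology')
  show "lift_homeo (swap_blocks n) \<in> carrier (homeo_group C)" for n
    by (rule lift_homeo_carrier[OF homeomorphism_swap_blocks])
  fix g U
  assume g: "g \<in> carrier (homeo_group C)"
    and U: "openin (homeo_topology C) U" "\<one>\<^bsub>homeo_group C\<^esub> \<in> U"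
  obtain v v' where v: "homeomorphism UNIV UNIV v v'" "g = lift_homeo v"
    by (rule carrier_lift_homeo[OF g])
  obtain m where m: "\<And>u u'. homeomorphism UNIV UNIV u u' \<Longrightarrow> \<forall>x. agree m (u x) x \<Longrightarrow> lift_homeo u \<in> U"
    using lift_homeo_near_one[OF U] by blast
  show "\<forall>\<^sub>F n in sequentially. \<exists>u\<in>U \<inter> carrier (homeo_group C). \<exists>w\<in>U \<inter> carrier (homeo_group C).
    g \<otimes>\<^bsub>homeo_group C\<^esub> lift_homeo (swap_blocks n)
      = u \<otimes>\<^bsub>homeo_group C\<^esub> lift_homeo (swap_blocks n) \<otimes>\<^bsub>homeo_group C\<^esub> w"
    using swap_blocks_factorization[OF v(1), of m]
  proof (rule eventually_mono, elim exE conjE)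
    fix n u u' w w'
    assume u: "homeomorphism UNIV UNIV u u'" "\<forall>x. agree m (u x) x"
      and w: "homeomorphism UNIV UNIV w w'" "\<forall>x. agree m (w x) x"
      and eq: "v \<circ> swap_blocks n = u \<circ> swap_blocks n \<circ> w"
    note s = homeomorphism_swap_blocks[of n]
    have "g \<otimes>\<^bsub>homeo_group C\<^esub> lift_homeo (swap_blocks n)
        = lift_homeo u \<otimes>\<^bsub>homeo_group C\<^esub> lift_homeo (swap_blocks n) \<otimes>\<^bsub>homeo_group C\<^esub> lift_homeo w"
      by (simp only: v(2) lift_homeo_mult[OF v(1) s] lift_homeo_mult[OF u(1) s]
          lift_homeo_mult[OF homeomorphism_compose[OF s u(1)] w(1)] eq)
    then show "\<exists>u\<in>U \<inter> carrier (homeo_group C). \<exists>w\<in>U \<inter> carrier (homeo_group C).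
        g \<otimes>\<^bsub>homeo_group C\<^esub> lift_homeo (swap_blocks n)
          = u \<otimes>\<^bsub>homeo_group C\<^esub> lift_homeo (swap_blocks n) \<otimes>\<^bsub>homeo_group C\<^esub> w"
      using m[OF u] m[OF w] lift_homeo_carrier[OF u(1)] lift_homeo_carrier[OF w(1)] by blast
  qed
qed

end

theorem corollary14p4:
  fixes C :: "'c metric"
  assumes "mtopology_of C homeomorphic_space cantor_topology"
  shows "(\<forall>(M :: 'm topology) \<phi>.
            universal_minimal_flow (homeo_group C) (homeo_topology C) M \<phi> \<longrightarrow>
            SUC_trivial (homeo_group C) (homeo_topology C) M \<phi>) \<and>
         SUC_fpp (homeo_group C) (homeo_topology C) TYPE('y)"
proof -
  obtain \<Phi> :: "'c \<Rightarrow> nat \<Rightarrow> bool" and \<Psi> where "homeomorphic_maps (mtopology_of C) euclidean \<Phi> \<Psi>"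
    using assms unfolding cantor_topology_euclidean homeomorphic_space_def by blast
  \<comment> \<open>The property is available for every carrier type: it is used at
    \<open>'m set set\<close> for SUC-triviality and at \<open>'y\<close> for the second
    claim.\<close>
  note fpp = SUC_fpp_homeo_group[OF this]
  show ?thesis
    using SUC_trivial_minimal_flow[OF fpp] fpp unfolding universal_minimal_flow_def by blast
qed

end
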